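(* There exists $C\in(0,\infty)$ such that for any Borel set $E\subseteq K$, any open neighborhood $E'$ of the closure $\overline{E}$ in $K$ and any $u\in\mathcal{F}_{p,\mathrm{loc}}(E')$, $$\limsup_{s\downarrow0}\int_E\frac{1}{m(B(x,s))}\int_{B(x,s)}\frac{|u(x)-u(y)|^p}{s^{d_{\mathrm f,p}+p-1}}\,m(dy)\,m(dx)\le C\,\Gamma_{\mathcal{E}_p}\langle u\rangle\bigl(\overline{E}\bigr).$$ Moreover, with the same $C$, for any $f\in L^p(K,m)$, $$\sup_{s>0}\int_K\frac{1}{m(B(x,s))}\int_{B(x,s)}\frac{|f(x)-f(y)|^p}{s^{d_{\mathrm f,p}+p-1}}\,m(dy)\,m(dx)\le C\,\mathcal{E}_p(f),$$ where $\mathcal{E}_p(f):=\infty$ for $f\in L^p(K,m)\setminus\mathcal{F}_p$.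
   Context: Self-similar structure. $K$ is a compact metrizable space, $S$ a finite set with $\#S\ge2$, $F_i\colon K\to K$ ($i\in S$) continuous injections, $K_i=F_i(K)$. $\mathcal{L}=(K,S,\{F_i\}_{i\in S})$ is a self-similar structure if there is a continuous surjection $\chi\colon S^{\mathbb{N}}\to K$ with $F_i\circ\chi=\chi\circ\sigma_i$, $\sigma_i(\omega_1\omega_2\dots)=i\omega_1\omega_2\dots$. It is post-critically finite (p.-c.f.) if $\bigcup_{n\ge1}\sigma^n(\mathcal{C})$ is finite, where $\mathcal{C}=\chi^{-1}(\bigcup_{i\ne j}K_i\cap K_j)$ and $\sigma$ is the left shift. A self-similar measure with weight $(\theta_i)$ ($\theta_i\in(0,1)$, $\sum\theta_i=1$) is a Borel probability measure $m$ with $m=\sum_i\theta_i(F_i)_*m$. $p$-resistance form on $K$: a pair $(\mathcal{E},\mathcal{F})$ with $\mathcal{F}\subseteq\mathbb{R}^K$ a linear subspace containing $\mathbb{R}\mathbf{1}_K$, $\mathcal{E}\colon\mathcal{F}\to[0,\infty)$ with $\mathcal{E}^{1/p}$ a seminorm with null space $\mathbb{R}\mathbf{1}_K$; $(\mathcal{F}/\mathbb{R}\mathbf{1}_K,\mathcal{E}^{1/p})$ is Banach; $\mathcal{F}$ separates points; $R_{\mathcal{E}}(x,y)=\sup\{|u(x)-u(y)|^p/\mathcal{E}(u):u\in\mathcal{F}\setminus\mathbb{R}\mathbf{1}_K\}<\infty$ for all $x,y$; and $(\mathrm{GC})_p$: whenever $n_1,n_2\in\mathbb{N}$, $q_1\in(0,p]$,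 $q_2\in[p,\infty]$, $T\colon\mathbb{R}^{n_1}\to\mathbb{R}^{n_2}$, $T(0)=0$ and $\|T(x)-T(y)\|_{\ell^{q_2}}\le\|x-y\|_{\ell^{q_1}}$ for all $x,y$, then for all $\boldsymbol{u}\in\mathcal{F}^{n_1}$, $T(\boldsymbol{u})\in\mathcal{F}^{n_2}$ and $\|(\mathcal{E}(T_l(\boldsymbol{u}))^{1/p})_l\|_{\ell^{q_2}}\le\|(\mathcal{E}(u_k)^{1/p})_k\|_{\ell^{q_1}}$ ($\|x\|_{\ell^q}=(\sum|x_k|^q)^{1/q}$ for $q<\infty$, $\|x\|_{\ell^\infty}=\max|x_k|$). Under $(\mathrm{GC})_p$, $\mathcal{E}(u;v):=\frac1p\frac{d}{dt}\mathcal{E}(u+tv)|_{t=0}$ exists. Standing assumption. $p\in(1,\infty)$; $\mathcal{L}$ is a p.-c.f. self-similar structure with $\#S\ge2$ and $K$ connected; $(\mathcal{E}_p,\mathcal{F}_p)$ is a self-similar $p$-resistance form on $\mathcal{L}$ with weight $(\rho_{p,i})_{i\in S}\in(0,\infty)^S$, i.e. a $p$-resistance form on $K$ with $\mathcal{F}_p\subseteq C(K)$, $\mathcal{F}_p=\{u\in C(K):u\circ F_i\in\mathcal{F}_p\ \forall i\}$, $\mathcal{E}_p(u)=\sum_i\rho_{p,i}\mathcal{E}_p(u\circ F_i)$ for $u\in\mathcal{F}_p$; and $\min_i\rho_{p,i}>1$. $d_{\mathrm f,p}>0$ satisfies $\sum_i\rho_{p,i}^{-d_{\mathrm f,p}/(p-1)}=1$;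 $m$ is the self-similar measure with weight $(\rho_{p,i}^{-d_{\mathrm f,p}/(p-1)})_{i\in S}$. $\widehat R_p(x,y)=R_{\mathcal{E}_p}(x,y)^{1/(p-1)}$ is the $p$-resistance metric (known to be a metric giving the topology of $K$), and $B(x,s)=\{y\in K:\widehat R_p(x,y)<s\}$. Continuous functions are identified with their $m$-classes. $p$-energy measures. For $u\in\mathcal{F}_p$, $\Gamma_{\mathcal{E}_p}\langle u\rangle$ is the unique positive Radon measure on $K$ (known to exist) with $\int_K\varphi\,d\Gamma_{\mathcal{E}_p}\langle u\rangle=\mathcal{E}_p(u;u\varphi)-(\frac{p-1}{p})^{p-1}\mathcal{E}_p(|u|^{p/(p-1)};\varphi)$ for all $\varphi\in\mathcal{F}_p$. It is known that $\Gamma_{\mathcal{E}_p}\langle u\rangle(A)=\Gamma_{\mathcal{E}_p}\langle v\rangle(A)$ if $u-v$ is constant on the Borel set $A$. For a non-empty open $U\subseteq K$, $\mathcal{F}_{p,\mathrm{loc}}(U)$ is the set of $f\in C(U)$ such that for each relatively compact open subset $A$ of $U$ there is $f^{\#}\in\mathcal{F}_p$ with $f|_A=f^{\#}|_A$. For such $f$, $\Gamma_{\mathcal{E}_p}\langle f\rangle$ is the Radon measure on $U$ with $\Gamma_{\mathcal{E}_p}\langle f\rangle(E)=\Gamma_{\mathcal{E}_p}\langle f^{\#}\rangle(E)$ for every relatively compact Borel $E\subseteq U$, where $A$ is any relatively compact open subset of $U$ with $A\supseteq E$ and $f^{\#}\in\mathcal{F}_p$ is any function with $f|_A=f^{\#}|_A$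 (the value does not depend on the choice of $A$ and $f^{\#}$). *)

theory Defs
  imports "HOL-Analysis.Analysis"
begin

section \<open>Self-similar structures\<close>

text \<open>
  The compact metrizable space \<open>K\<close> is a whole type \<open>'a::metric_space\<close> whose universe is assumed to be
  compact; the metric \<^const>\<open>dist\<close> only provides the topology and the Borel sets. The finite set \<open>S\<close>
  is a type \<open>'s::finite\<close>, and words in \<open>S\<^sup>\<nat>\<close> are functions \<open>nat \<Rightarrow> 's\<close>, indexed from \<open>0\<close>.
\<close>

definition shift :: "(nat \<Rightarrow> 's) \<Rightarrow> nat \<Rightarrow> 's" where
  "shift \<omega> = (\<lambda>n. \<omega> (Suc n))"

definition prepend :: "'s \<Rightarrow> (nat \<Rightarrow> 's) \<Rightarrow> nat \<Rightarrow> 's" where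
  "prepend i \<omega> = case_nat i \<omega>"

definition coding_map :: "('s::finite \<Rightarrow> 'a::metric_space \<Rightarrow> 'a) \<Rightarrow> ((nat \<Rightarrow> 's) \<Rightarrow> 'a) \<Rightarrow> bool" where
  "coding_map F chi \<longleftrightarrow>
     continuous_map (product_topology (\<lambda>_::nat. discrete_topology (UNIV::'s set)) UNIV) euclidean chi \<and>
     surj chi \<and> (\<forall>i. F i \<circ> chi = chi \<circ> prepend i)"

definition self_similar_structure :: "('s::finite \<Rightarrow> 'a::metric_space \<Rightarrow> 'a) \<Rightarrow> bool" where
  "self_similar_structure F \<longleftrightarrow>
     compact (UNIV :: 'a set) \<and> CARD('s) \<ge> 2 \<and>
     (\<forall>i. continuous_on UNIV (F i) \<and> inj (F i)) \<and> (\<exists>chi. coding_map F chi)"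

definition critical_set :: "('s \<Rightarrow> 'a \<Rightarrow> 'a) \<Rightarrow> ((nat \<Rightarrow> 's) \<Rightarrow> 'a) \<Rightarrow> (nat \<Rightarrow> 's) set" where
  "critical_set F chi = chi -` (\<Union>i. \<Union>j\<in>-{i}. range (F i) \<inter> range (F j))"

text \<open>A self-similar structure has only one coding map, so the existential quantifier is harmless.\<close>

definition pcf_self_similar_structure :: "('s::finite \<Rightarrow> 'a::metric_space \<Rightarrow> 'a) \<Rightarrow> bool" where
  "pcf_self_similar_structure F \<longleftrightarrow> self_similar_structure F \<and>
     (\<exists>chi. coding_map F chi \<and> finite (\<Union>n\<in>{1..}. (shift ^^ n) ` critical_set F chi))"

definition self_similar_measure ::
    "('s::finite \<Rightarrow> 'a::metric_space \<Rightarrow> 'a) \<Rightarrow> ('s \<Rightarrow> real) \<Rightarrow> 'a measure \<Rightarrow> bool" where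
  "self_similar_measure F \<theta> m \<longleftrightarrow>
     (\<forall>i. 0 < \<theta> i \<and> \<theta> i < 1) \<and> (\<Sum>i\<in>UNIV. \<theta> i) = 1 \<and>
     sets m = sets borel \<and> emeasure m UNIV = 1 \<and>
     (\<forall>A\<in>sets borel. emeasure m A = (\<Sum>i\<in>UNIV. ennreal (\<theta> i) * emeasure (distr m borel (F i)) A))"


section \<open>p-resistance forms\<close>

text \<open>
  A form is a pair of a total function \<open>\<E>\<close> and a domain \<open>\<F>\<close>; values of \<open>\<E>\<close> outside \<open>\<F>\<close> carry no
  information. A vector of length \<open>n\<close> is a function on \<open>nat\<close> of which only the values below \<open>n\<close> count.
\<close>

definition lq_norm :: "ereal \<Rightarrow> nat \<Rightarrow> (nat \<Rightarrow> real) \<Rightarrow> real" where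
  "lq_norm q n x =
     (if q = \<infinity> then Max ((\<lambda>k. \<bar>x k\<bar>) ` {..<n})
      else (\<Sum>k<n. \<bar>x k\<bar> powr real_of_ereal q) powr (1 / real_of_ereal q))"

text \<open>
  The contraction hypothesis below forces the first \<open>n2\<close> entries of \<open>T x\<close> to depend on the first \<open>n1\<close>
  entries of \<open>x\<close> only, so \<open>T\<close> ranges precisely over the maps between the finite-dimensional spaces.
\<close>

definition generalized_contraction :: "real \<Rightarrow> (('a \<Rightarrow> real) \<Rightarrow> real) \<Rightarrow> ('a \<Rightarrow> real) set \<Rightarrow> bool" where
  "generalized_contraction p \<E> \<F> \<longleftrightarrow>
     (\<forall>(n1::nat) (n2::nat) (q1::ereal) (q2::ereal) (T :: (nat \<Rightarrow> real) \<Rightarrow> nat \<Rightarrow> real).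
        n1 \<ge> 1 \<and> n2 \<ge> 1 \<and> 0 < q1 \<and> q1 \<le> ereal p \<and> ereal p \<le> q2 \<and>
        (\<forall>l<n2. T (\<lambda>_. 0) l = 0) \<and>
        (\<forall>x y. lq_norm q2 n2 (\<lambda>l. T x l - T y l) \<le> lq_norm q1 n1 (\<lambda>k. x k - y k)) \<longrightarrow>
        (\<forall>u :: nat \<Rightarrow> 'a \<Rightarrow> real. (\<forall>k<n1. u k \<in> \<F>) \<longrightarrow>
           (\<forall>l<n2. (\<lambda>x. T (\<lambda>k. u k x) l) \<in> \<F>) \<and>
           lq_norm q2 n2 (\<lambda>l. \<E> (\<lambda>x. T (\<lambda>k. u k x) l) powr (1/p))
             \<le> lq_norm q1 n1 (\<lambda>k. \<E> (u k) powr (1/p))))"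

definition p_resistance ::
    "real \<Rightarrow> (('a \<Rightarrow> real) \<Rightarrow> real) \<Rightarrow> ('a \<Rightarrow> real) set \<Rightarrow> 'a \<Rightarrow> 'a \<Rightarrow> ennreal" where
  "p_resistance p \<E> \<F> x y =
     (SUP u \<in> \<F> - range (\<lambda>c _. c). ennreal (\<bar>u x - u y\<bar> powr p / \<E> u))"

text \<open>
  Completeness of \<open>\<F>\<close> modulo constants is spelled out for sequences of representatives.
\<close>

definition p_resistance_form :: "real \<Rightarrow> (('a \<Rightarrow> real) \<Rightarrow> real) \<Rightarrow> ('a \<Rightarrow> real) set \<Rightarrow> bool" where
  "p_resistance_form p \<E> \<F> \<longleftrightarrow>
     (\<forall>c. (\<lambda>_. c) \<in> \<F>) \<and>
     (\<forall>u\<in>\<F>. \<forall>v\<in>\<F>. (\<lambda>x. u x + v x) \<in> \<F>) \<and>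
     (\<forall>u\<in>\<F>. \<forall>c. (\<lambda>x. c * u x) \<in> \<F>) \<and>
     (\<forall>u\<in>\<F>. \<E> u \<ge> 0) \<and>
     (\<forall>u\<in>\<F>. \<forall>v\<in>\<F>. \<E> (\<lambda>x. u x + v x) powr (1/p) \<le> \<E> u powr (1/p) + \<E> v powr (1/p)) \<and>
     (\<forall>u\<in>\<F>. \<forall>c. \<E> (\<lambda>x. c * u x) powr (1/p) = \<bar>c\<bar> * \<E> u powr (1/p)) \<and>
     (\<forall>u\<in>\<F>. \<E> u = 0 \<longleftrightarrow> (\<exists>c. u = (\<lambda>_. c))) \<and>
     (\<forall>X :: nat \<Rightarrow> 'a \<Rightarrow> real.
        (\<forall>n. X n \<in> \<F>) \<and>
        (\<forall>e>0. \<exists>N. \<forall>j\<ge>N. \<forall>k\<ge>N. \<E> (\<lambda>x. X j x - X k x) powr (1/p) < e) \<longrightarrow>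
        (\<exists>u\<in>\<F>. (\<lambda>n. \<E> (\<lambda>x. X n x - u x) powr (1/p)) \<longlonglongrightarrow> 0)) \<and>
     (\<forall>x y. x \<noteq> y \<longrightarrow> (\<exists>u\<in>\<F>. u x \<noteq> u y)) \<and>
     (\<forall>x y. p_resistance p \<E> \<F> x y < \<infinity>) \<and>
     generalized_contraction p \<E> \<F>"

definition self_similar_p_resistance_form ::
    "('s::finite \<Rightarrow> 'a::metric_space \<Rightarrow> 'a) \<Rightarrow> real \<Rightarrow> ('s \<Rightarrow> real) \<Rightarrow>
     (('a \<Rightarrow> real) \<Rightarrow> real) \<Rightarrow> ('a \<Rightarrow> real) set \<Rightarrow> bool" where
  "self_similar_p_resistance_form F p \<rho> \<E> \<F> \<longleftrightarrow>
     (\<forall>i. \<rho> i > 0) \<and>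
     p_resistance_form p \<E> \<F> \<and>
     \<F> = {u. continuous_on UNIV u \<and> (\<forall>i. u \<circ> F i \<in> \<F>)} \<and>
     (\<forall>u\<in>\<F>. \<E> u = (\<Sum>i\<in>UNIV. \<rho> i * \<E> (u \<circ> F i)))"

definition p_resistance_metric ::
    "real \<Rightarrow> (('a \<Rightarrow> real) \<Rightarrow> real) \<Rightarrow> ('a \<Rightarrow> real) set \<Rightarrow> 'a \<Rightarrow> 'a \<Rightarrow> real" where
  "p_resistance_metric p \<E> \<F> x y = enn2real (p_resistance p \<E> \<F> x y) powr (1 / (p - 1))"

definition resistance_ball ::
    "real \<Rightarrow> (('a \<Rightarrow> real) \<Rightarrow> real) \<Rightarrow> ('a \<Rightarrow> real) set \<Rightarrow> 'a \<Rightarrow> real \<Rightarrow> 'a set" where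
  "resistance_ball p \<E> \<F> x s = {y. p_resistance_metric p \<E> \<F> x y < s}"


section \<open>p-energy measures\<close>

definition form_deriv ::
    "real \<Rightarrow> (('a \<Rightarrow> real) \<Rightarrow> real) \<Rightarrow> ('a \<Rightarrow> real) \<Rightarrow> ('a \<Rightarrow> real) \<Rightarrow> real" where
  "form_deriv p \<E> u v = 1 / p * deriv (\<lambda>t. \<E> (\<lambda>x. u x + t * v x)) 0"

text \<open>On a compact metric space the positive Radon measures are the finite Borel measures.\<close>

definition is_p_energy_measure ::
    "real \<Rightarrow> (('a::metric_space \<Rightarrow> real) \<Rightarrow> real) \<Rightarrow> ('a \<Rightarrow> real) set \<Rightarrow> ('a \<Rightarrow> real) \<Rightarrow> 'a measure \<Rightarrow> bool" where
  "is_p_energy_measure p \<E> \<F> u \<mu> \<longleftrightarrow>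
     sets \<mu> = sets borel \<and> finite_measure \<mu> \<and>
     (\<forall>\<phi>\<in>\<F>. (\<integral>x. \<phi> x \<partial>\<mu>) =
        form_deriv p \<E> u (\<lambda>x. u x * \<phi> x)
        - ((p - 1) / p) powr (p - 1) * form_deriv p \<E> (\<lambda>x. \<bar>u x\<bar> powr (p / (p - 1))) \<phi>)"

definition rel_compact :: "'a::metric_space set \<Rightarrow> 'a set \<Rightarrow> bool" where
  "rel_compact U A \<longleftrightarrow> compact (closure A) \<and> closure A \<subseteq> U"

text \<open>An element of \<open>C(U)\<close> is a total function that is continuous on \<open>U\<close>.\<close>

definition local_domain :: "('a::metric_space \<Rightarrow> real) set \<Rightarrow> 'a set \<Rightarrow> ('a \<Rightarrow> real) set" where
  "local_domain \<F> U =
     {f. continuous_on U f \<and>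
         (\<forall>A. open A \<and> rel_compact U A \<longrightarrow> (\<exists>g\<in>\<F>. \<forall>x\<in>A. f x = g x))}"

text \<open>
  On an open subset of a compact metric space the Radon measures are the Borel measures that are finite
  on compact sets. The argument \<open>\<Gamma>\<close> assigns to each element of \<open>\<F>\<close> its p-energy measure.
\<close>

definition is_local_p_energy_measure ::
    "('a::metric_space \<Rightarrow> real) set \<Rightarrow> (('a \<Rightarrow> real) \<Rightarrow> 'a measure) \<Rightarrow> 'a set \<Rightarrow> ('a \<Rightarrow> real) \<Rightarrow>
     'a measure \<Rightarrow> bool" where
  "is_local_p_energy_measure \<F> \<Gamma> U f \<nu> \<longleftrightarrow>
     sets \<nu> = sets (restrict_space borel U) \<and>
     (\<forall>A. compact A \<and> A \<subseteq> U \<longrightarrow> emeasure \<nu> A < \<infinity>) \<and>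
     (\<forall>E A g. E \<in> sets borel \<and> rel_compact U E \<and> open A \<and> rel_compact U A \<and> E \<subseteq> A \<and>
              g \<in> \<F> \<and> (\<forall>x\<in>A. f x = g x) \<longrightarrow>
        emeasure \<nu> E = emeasure (\<Gamma> g) E)"


section \<open>Korevaar--Schoen functionals and the extended energy\<close>

definition korevaar_schoen ::
    "real \<Rightarrow> (('a \<Rightarrow> real) \<Rightarrow> real) \<Rightarrow> ('a \<Rightarrow> real) set \<Rightarrow> real \<Rightarrow> 'a measure \<Rightarrow>
     'a set \<Rightarrow> ('a \<Rightarrow> real) \<Rightarrow> real \<Rightarrow> ennreal" where
  "korevaar_schoen p \<E> \<F> d m E u s =
     (\<integral>\<^sup>+x\<in>E. (1 / emeasure m (resistance_ball p \<E> \<F> x s) *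
        (\<integral>\<^sup>+y\<in>resistance_ball p \<E> \<F> x s.
           ennreal (\<bar>u x - u y\<bar> powr p / s powr (d + p - 1)) \<partial>m)) \<partial>m)"

text \<open>
  The energy of an \<open>m\<close>-class represented by \<open>f\<close>: the class belongs to \<open>\<F>\<close> if it contains an element of
  \<open>\<F>\<close>. The latter is unique if \<open>\<F>\<close> consists of continuous functions and \<open>m\<close> has full support.
\<close>

definition extended_energy ::
    "(('a \<Rightarrow> real) \<Rightarrow> real) \<Rightarrow> ('a \<Rightarrow> real) set \<Rightarrow> 'a measure \<Rightarrow> ('a \<Rightarrow> real) \<Rightarrow> ennreal" where
  "extended_energy \<E> \<F> m f =
     (if \<exists>v\<in>\<F>. AE x in m. f x = v x
      then ennreal (\<E> (THE v. v \<in> \<F> \<and> (AE x in m. f x = v x)))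
      else \<infinity>)"

end

theory Submission
  imports Defs
begin

text \<open>
  The idea is to compare, at every scale \<open>s\<close>, the Korevaar--Schoen functional with
  the energies of the function on the cells \<open>F\<^sub>w(K)\<close> of resistance diameter
  comparable to \<open>s\<close>. Write \<open>\<rho>\<^sub>w\<close> for the product of the
  weights along the word \<open>w\<close>. Self-similarity gives \<open>\<E>(u) = \<Sum>\<^sub>w
  \<rho>\<^sub>w \<E>(u \<circ> F\<^sub>w)\<close>, where \<open>w\<close> runs through the words
  whose contraction factor \<open>\<rho>\<^sub>w powr (- 1 / (p - 1))\<close> has just dropped to
  \<open>s\<close> or below. Since the resistance is bounded (\<open>oscillation_bound\<close>),
  the oscillation of \<open>u\<close> on such a cell, to the power \<open>p\<close>, is at most a
  constant times \<open>s powr (p - 1)\<close> times the cell energy \<open>\<rho>\<^sub>w \<E>(u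
  \<circ> F\<^sub>w)\<close>. The cell has mass at most a constant times \<open>s powr d\<close>.
  So, if a ball of radius \<open>s\<close> around a point of a cell is contained in that cell and
  its neighbours, the functional is bounded by a constant times the sum of the energies of the
  cells near \<open>E\<close>; the powers of \<open>s\<close> cancel
  (\<open>korevaar_schoen_le_cell_energies\<close>).

  That balls have this property, after adjusting the scale by a constant factor, is where
  post-critical finiteness enters. Cells of one partition meet only in images of a finite boundary
  set (\<open>cells_meet_in_boundary\<close>), so each cell has a bounded number of neighbours
  (\<open>card_neighbours\<close>), and there is a cutoff function that is \<open>1\<close> on a
  given cell and \<open>0\<close> on the cells that do not touch it, glued from finitely many
  functions. Its energy is at most a constant times \<open>s powr (- (p - 1))\<close>, which means
  that cells that do not touch are at distance at least a multiple of \<open>s\<close>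
  (\<open>resistance_between_separated_cells\<close>).

  Summing over all cells gives the bound by \<open>\<E>(f)\<close> for \<open>E = K\<close>,
  uniformly in \<open>s\<close>. For the localized statement the cell energies near
  \<open>E\<close> are bounded by the energy measure of a neighbourhood of the closure of
  \<open>E\<close> (\<open>cell_energies_le_energy_measure\<close>). This follows from the
  self-similarity of energy measures, tested on cutoff functions, which in turn follows from their
  defining identity once the derivatives in it are known to exist
  (\<open>energy_differentiable\<close>). Letting the neighbourhood shrink gives the claim
  (\<open>Limsup_korevaar_schoen_le\<close>).
\<close>

section \<open>Consequences of the generalized contraction property\<close>

text \<open>
  For a convex function the difference quotients to the left of \<open>0\<close> lie below those
  to the right, so the infimum \<open>L\<close> of the right quotients separates the two families.
  A second difference of size \<open>o(t)\<close> leaves no gap between the families, and then all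
  quotients converge to \<open>L\<close>. The first hypothesis is convexity at \<open>0\<close>
  with denominators cleared.
\<close>

lemma differentiable_at_0_if_second_difference_small:
  fixes f e :: "real \<Rightarrow> real"
  assumes cvx: "\<And>s t. 0 < s \<Longrightarrow> 0 < t \<Longrightarrow> (s + t) * f 0 \<le> t * f (- s) + s * f t"
    and gap: "\<And>t. 0 < t \<Longrightarrow> f t + f (- t) - 2 * f 0 \<le> e t"
    and e: "((\<lambda>t. e t / t) \<longlongrightarrow> 0) (at_right 0)"
  shows "f differentiable (at 0)"
proof -
  define q where "q t = (f t - f 0) / t" for t
  define L where "L = Inf (q ` {0<..})"
  have slope: "q (- s) \<le> q t" if "0 < s" "0 < t" for s t
    using cvx[OF that] that by (simp add: q_def field_simps)
  have bdd: "bdd_below (q ` {0<..})" 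
    using slope[of 1] by (intro bdd_belowI[of _ "q (-1)"]) auto
  have le: "L \<le> q t" "q (- t) \<le> L" if "0 < t" for t
    unfolding L_def using bdd that slope[OF that] by (auto intro!: cINF_lower cINF_greatest simp: ex_in_conv[symmetric] intro: exI[of _ 1])
  have qgap: "q t - q (- t) \<le> e t / t" if "0 < t" for t
  proof -
    have "q t - q (- t) = (f t + f (- t) - 2 * f 0) / t" using that by (simp add: q_def field_simps)
    thus ?thesis using gap[OF that] that by (simp add: divide_right_mono)
  qed
  have bound: "\<bar>q h - L\<bar> \<le> e \<bar>h\<bar> / \<bar>h\<bar>" if "h \<noteq> 0" for h
    using le[of "\<bar>h\<bar>"] qgap[of "\<bar>h\<bar>"] that by (cases "h > 0") auto
  have abs0: "filterlim (\<lambda>h::real. \<bar>h\<bar>) (at_right 0) (at 0)"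
    unfolding filterlim_at by (auto intro!: tendsto_eq_intros simp: eventually_at_filter)
  have "((\<lambda>h. q h - L) \<longlongrightarrow> 0) (at 0)"
    by (rule Lim_null_comparison[OF _ filterlim_compose[OF e abs0]])
       (auto simp: eventually_at_filter bound)
  hence "(q \<longlongrightarrow> L) (at 0)" by (simp add: LIM_zero_iff)
  hence "(f has_real_derivative L) (at 0)" by (simp add: has_field_derivative_iff q_def[abs_def])
  thus ?thesis by (auto simp: real_differentiable_def)
qed

text \<open>
  Adding this bound for \<open>h\<close> and \<open>- h\<close> cancels the linear term; only the
  quadratic error counts, and its constant \<open>4 ^ n\<close> is merely convenient for the
  induction.
\<close>

lemma one_plus_power_le_quadratic:
  fixes h :: real assumes "\<bar>h\<bar> \<le> 1"
  shows "(1 + h) ^ n \<le> 1 + real n * h + 4 ^ n * h\<^sup>2"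
proof (induction n)
  case (Suc n)
  have n4: "real n \<le> 4 ^ n" 
    using of_nat_less_two_power[of n, where 'a=real] power_mono[of 2 "4::real" n] by linarith
  have "(1 + h) ^ Suc n \<le> (1 + h) * (1 + real n * h + 4 ^ n * h\<^sup>2)"
    using Suc assms by (simp add: mult_left_mono)
  also have "\<dots> = 1 + real (Suc n) * h + (real n + 4 ^ n + 4 ^ n * h) * h\<^sup>2"
    by (simp add: algebra_simps power2_eq_square)
  also have "\<dots> \<le> 1 + real (Suc n) * h + 4 ^ Suc n * h\<^sup>2"
  proof -
    have "4 ^ n * h \<le> 4 ^ n * (1::real)" using assms by (intro mult_left_mono) auto
    moreover have "4 ^ Suc n = 4 * (4::real) ^ n" "0 \<le> (4::real) ^ n" by simp_all
    ultimately have "real n + 4 ^ n + 4 ^ n * h \<le> 4 ^ Suc n" using n4 by linarith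
    thus ?thesis by (simp add: mult_right_mono)
  qed
  finally show ?case .
qed simp

text \<open>
  A crude relative of Clarkson's inequality. It says that \<open>(x, y) \<mapsto> (x + y, x -
  y)\<close>, up to a factor and a rescaling of \<open>y\<close>, is a contraction from
  \<open>\<ell>\<^sup>r\<close> to \<open>\<ell>\<^sup>n\<close> on the plane. The constant in
  front of \<open>\<bar>y\<bar> powr r\<close> may be any number, since \<open>y\<close> is
  eventually multiplied by a small parameter; what matters is that \<open>\<bar>x\<bar> powr
  r\<close> has coefficient \<open>1\<close>. By homogeneity only \<open>h = y / x\<close> counts:
  for \<open>\<bar>h\<bar> \<le> 1\<close> the odd powers of \<open>h\<close> cancel, and for
  \<open>\<bar>h\<bar> > 1\<close> the right-hand side dominates trivially.
\<close>

lemma two_point_inequality: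
  fixes x y r :: real and n :: nat
  assumes n: "even n" "2 \<le> n" and r: "1 \<le> r" "r \<le> 2"
  shows "(x + y) ^ n + (x - y) ^ n \<le> 2 * (\<bar>x\<bar> powr r + 4 ^ n * \<bar>y\<bar> powr r) powr (n / r)"
proof (cases "\<bar>y\<bar> \<le> \<bar>x\<bar>")
  case False
  have "(x + y) ^ n + (x - y) ^ n = \<bar>x + y\<bar> ^ n + \<bar>x - y\<bar> ^ n"
    using n by (simp add: power_even_abs)
  also have "\<dots> \<le> (2 * \<bar>y\<bar>) ^ n + (2 * \<bar>y\<bar>) ^ n"
    using False by (intro add_mono power_mono) auto
  also have "\<dots> = 2 * (2 * \<bar>y\<bar>) powr n" using False n by (subst powr_realpow) auto
  also have "(2 * \<bar>y\<bar>) powr n = (2 powr r * \<bar>y\<bar> powr r) powr (n / r)"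
    using r by (simp add: powr_mult powr_powr)
  also have "\<dots> \<le> (\<bar>x\<bar> powr r + 4 ^ n * \<bar>y\<bar> powr r) powr (n / r)"
  proof (intro powr_mono2)
    have "2 powr r \<le> 2 powr (2::real)" using r by (intro powr_mono) auto
    also have "\<dots> \<le> 4 ^ n" using n power_increasing[of 1 n "4::real"] by simp
    finally have "2 powr r * \<bar>y\<bar> powr r \<le> 4 ^ n * \<bar>y\<bar> powr r" by (rule mult_right_mono) simp
    thus "2 powr r * \<bar>y\<bar> powr r \<le> \<bar>x\<bar> powr r + 4 ^ n * \<bar>y\<bar> powr r" by (simp add: add_increasing)
  qed (use r in auto)
  finally show ?thesis by simp
next
  case True
  show ?thesis
  proof (cases "x = 0")
    case True with \<open>\<bar>y\<bar> \<le> \<bar>x\<bar>\<close> n show ?thesis by (simp add: power_0_left)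
  next
    case x: False
    define h where "h = y / x"
    have h: "\<bar>h\<bar> \<le> 1" and y: "y = x * h" using True x by (auto simp: h_def)
    have "(x + y) ^ n + (x - y) ^ n = x ^ n * ((1 + h) ^ n + (1 + - h) ^ n)"
      by (simp add: y distrib_left power_mult_distrib[symmetric] right_diff_distrib)
    also have "\<dots> \<le> x ^ n * (2 * (1 + 4 ^ n * h\<^sup>2))"
      using one_plus_power_le_quadratic[of h n] one_plus_power_le_quadratic[of "-h" n] h n
      by (intro mult_left_mono) (auto simp: zero_le_even_power)
    also have "\<dots> \<le> x ^ n * (2 * (1 + 4 ^ n * \<bar>h\<bar> powr r) powr (n / r))"
    proof (intro mult_left_mono)
      have "h\<^sup>2 = \<bar>h\<bar> powr 2" by simp
      also have "\<dots> \<le> \<bar>h\<bar> powr r" using h r by (intro powr_mono') auto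
      finally have "h\<^sup>2 \<le> \<bar>h\<bar> powr r" .
      hence "1 + 4 ^ n * h\<^sup>2 \<le> (1 + 4 ^ n * \<bar>h\<bar> powr r) powr 1" by simp
      also have "\<dots> \<le> (1 + 4 ^ n * \<bar>h\<bar> powr r) powr (n / r)"
        using r n by (intro powr_mono) auto
      finally show "1 + 4 ^ n * h\<^sup>2 \<le> (1 + 4 ^ n * \<bar>h\<bar> powr r) powr (n / r)" .
    qed (use n in \<open>auto simp: zero_le_even_power\<close>)
    also have "x ^ n = (\<bar>x\<bar> powr r) powr (n / r)"
      using x r n by (simp add: powr_powr powr_realpow power_even_abs)
    also have "\<dots> * (2 * (1 + 4 ^ n * \<bar>h\<bar> powr r) powr (n / r)) =
       2 * (\<bar>x\<bar> powr r * (1 + 4 ^ n * \<bar>h\<bar> powr r)) powr (n / r)"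
      by (simp add: powr_mult)
    also have "\<bar>x\<bar> powr r * (1 + 4 ^ n * \<bar>h\<bar> powr r) = \<bar>x\<bar> powr r + 4 ^ n * \<bar>y\<bar> powr r"
      by (simp add: y abs_mult powr_mult algebra_simps)
    finally show ?thesis by simp
  qed
qed

locale resistance_form =
  fixes p :: real and \<E> :: "('a::metric_space \<Rightarrow> real) \<Rightarrow> real" and \<F> :: "('a \<Rightarrow> real) set"
  assumes p_gt_1: "1 < p" and form: "p_resistance_form p \<E> \<F>"
begin

definition form_norm :: "('a \<Rightarrow> real) \<Rightarrow> real" where
  "form_norm u = \<E> u powr (1 / p)"

lemma const_mem: "(\<lambda>_. c) \<in> \<F>"
  and add_mem: "u \<in> \<F> \<Longrightarrow> v \<in> \<F> \<Longrightarrow> (\<lambda>x. u x + v x) \<in> \<F>"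
  and scale_mem: "u \<in> \<F> \<Longrightarrow> (\<lambda>x. c * u x) \<in> \<F>"
  and energy_nonneg: "u \<in> \<F> \<Longrightarrow> 0 \<le> \<E> u"
  and form_norm_triangle:
    "u \<in> \<F> \<Longrightarrow> v \<in> \<F> \<Longrightarrow> form_norm (\<lambda>x. u x + v x) \<le> form_norm u + form_norm v"
  and form_norm_scale: "u \<in> \<F> \<Longrightarrow> form_norm (\<lambda>x. c * u x) = \<bar>c\<bar> * form_norm u"
  and energy_eq_0_iff: "u \<in> \<F> \<Longrightarrow> \<E> u = 0 \<longleftrightarrow> (\<exists>c. u = (\<lambda>_. c))"
  and separates_points: "x \<noteq> y \<Longrightarrow> \<exists>u\<in>\<F>. u x \<noteq> u y"
  and p_resistance_finite: "p_resistance p \<E> \<F> x y < \<infinity>"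
  and contraction: "generalized_contraction p \<E> \<F>"
  using form unfolding p_resistance_form_def form_norm_def by (elim conjE, simp; fail)+

lemma form_norm_nonneg: "0 \<le> form_norm u"
  by (simp add: form_norm_def)

lemma energy_eq: "u \<in> \<F> \<Longrightarrow> \<E> u = form_norm u powr p"
  using p_gt_1 energy_nonneg[of u] by (simp add: form_norm_def powr_powr)

lemma form_norm_const: "form_norm (\<lambda>_. c) = 0"
  using energy_eq_0_iff[OF const_mem] by (auto simp: form_norm_def)

lemma energy_const: "\<E> (\<lambda>_. c) = 0"
  using energy_eq_0_iff[OF const_mem] by auto

lemma energy_scale: "u \<in> \<F> \<Longrightarrow> \<E> (\<lambda>x. c * u x) = \<bar>c\<bar> powr p * \<E> u"
  by (simp add: energy_eq scale_mem form_norm_scale powr_mult form_norm_nonneg)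

lemma diff_mem: "u \<in> \<F> \<Longrightarrow> v \<in> \<F> \<Longrightarrow> (\<lambda>x. u x - v x) \<in> \<F>"
  using add_mem[OF _ scale_mem[of v "-1"], of u] by simp

lemma form_norm_add_const:
  assumes u: "u \<in> \<F>" shows "form_norm (\<lambda>x. u x + c) = form_norm u"
proof (rule antisym)
  show "form_norm (\<lambda>x. u x + c) \<le> form_norm u"
    using form_norm_triangle[OF u const_mem] by (simp add: form_norm_const)
  show "form_norm u \<le> form_norm (\<lambda>x. u x + c)"
    using form_norm_triangle[OF add_mem[OF u const_mem[of c]] const_mem[of "-c"]] 
    by (simp add: form_norm_const)
qed

lemma energy_add_const: "u \<in> \<F> \<Longrightarrow> \<E> (\<lambda>x. u x + c) = \<E> u"
  by (simp add: energy_eq add_mem const_mem form_norm_add_const)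

text \<open>
  The case \<open>n\<^sub>1 = n\<^sub>2 = 1\<close> of the generalized contraction property;
  dividing by the Lipschitz constant and subtracting \<open>f 0\<close> turns \<open>f\<close>
  into a contraction that fixes \<open>0\<close>.
\<close>

lemma lipschitz_comp_mem:
  assumes u: "u \<in> \<F>" and lip: "\<And>s t. \<bar>f s - f t\<bar> \<le> L * \<bar>s - t\<bar>"
  shows "(\<lambda>x. f (u x)) \<in> \<F>"
proof -
  \<comment> \<open>the maximum makes division by \<open>L'\<close> safe\<close>
  define L' where "L' = max L 1"
  have "L' > 0" and L': "\<bar>f s - f t\<bar> \<le> L' * \<bar>s - t\<bar>" for s t
    using order_trans[OF lip mult_right_mono[of L L' "\<bar>s - t\<bar>"]] by (simp_all add: L'_def)
  define T :: "(nat \<Rightarrow> real) \<Rightarrow> nat \<Rightarrow> real" where "T = (\<lambda>x _. (f (x 0) - f 0) / L')"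
  have lq1: "lq_norm (ereal p) 1 x = \<bar>x 0\<bar>" for x
    using p_gt_1 by (simp add: lq_norm_def powr_powr)
  have T: "lq_norm (ereal p) 1 (\<lambda>l. T x l - T y l) \<le> lq_norm (ereal p) 1 (\<lambda>k. x k - y k)" for x y
    using \<open>L' > 0\<close> L'[of "x 0" "y 0"]
    by (simp add: T_def diff_divide_distrib[symmetric] divide_le_eq mult.commute lq1[simplified])
  have "(\<forall>l<(1::nat). (\<lambda>x. T (\<lambda>k. u x) l) \<in> \<F>)"
    using contraction[unfolded generalized_contraction_def, rule_format, of 1 1 "ereal p" "ereal p" T "\<lambda>_. u"]
      p_gt_1 T u by (simp add: T_def)
  hence "(\<lambda>x. (f (u x) - f 0) / L') \<in> \<F>" by (simp add: T_def)
  from add_mem[OF scale_mem[OF this, of L'] const_mem[of "f 0"]] \<open>L' > 0\<close> show ?thesis by simp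
qed

text \<open>
  Truncating the argument to \<open>[a, b]\<close> makes \<open>f\<close> globally Lipschitz and
  does not change \<open>f \<circ> u\<close>.
\<close>

lemma lipschitz_on_Icc_comp_mem:
  assumes u: "u \<in> \<F>" and bd: "\<And>x. a \<le> u x \<and> u x \<le> b" and ab: "a \<le> b"
    and lip: "\<And>s t. a \<le> s \<Longrightarrow> s \<le> t \<Longrightarrow> t \<le> b \<Longrightarrow> \<bar>f t - f s\<bar> \<le> L * (t - s)"
  shows "(\<lambda>x. f (u x)) \<in> \<F>"
proof -
  define clip where "clip t = max a (min b t)" for t
  define L' where "L' = max L 0"
  have lip': "\<bar>f s - f t\<bar> \<le> L' * \<bar>s - t\<bar>" if "a \<le> s" "s \<le> b" "a \<le> t" "t \<le> b" for s t
  proof -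
    have *: "\<bar>f t - f s\<bar> \<le> L' * (t - s)" if "a \<le> s" "s \<le> t" "t \<le> b" for s t
      using lip[OF that] that mult_right_mono[of L L' "t - s"] by (simp add: L'_def)
    show ?thesis
    proof (cases "s \<le> t")
      case True thus ?thesis using *[of s t] that by (simp add: abs_minus_commute)
    next
      case False thus ?thesis using *[of t s] that by simp
    qed
  qed
  have "\<bar>f (clip s) - f (clip t)\<bar> \<le> L' * \<bar>s - t\<bar>" for s t
  proof -
    have "\<bar>f (clip s) - f (clip t)\<bar> \<le> L' * \<bar>clip s - clip t\<bar>"
      using ab by (intro lip') (auto simp: clip_def)
    also have "\<dots> \<le> L' * \<bar>s - t\<bar>" by (intro mult_left_mono) (auto simp: clip_def L'_def)
    finally show ?thesis .
  qed
  from lipschitz_comp_mem[OF u this] have "(\<lambda>x. f (clip (u x))) \<in> \<F>" .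
  also have "(\<lambda>x. f (clip (u x))) = (\<lambda>x. f (u x))" using bd by (auto simp: clip_def fun_eq_iff)
  finally show ?thesis .
qed

lemma abs_powr_mem:
  assumes u: "u \<in> \<F>" and bd: "\<And>x. \<bar>u x\<bar> \<le> M" and q: "1 \<le> q"
  shows "(\<lambda>x. \<bar>u x\<bar> powr q) \<in> \<F>"
proof -
  have M: "0 \<le> M" using bd[of undefined] by linarith
  have abs: "(\<lambda>x. \<bar>u x\<bar>) \<in> \<F>" by (rule lipschitz_comp_mem[OF u, where L=1]) (simp add: abs_triangle_ineq3)
  show ?thesis
  proof (rule lipschitz_on_Icc_comp_mem[OF abs, where a=0 and b=M and L="q * M powr (q - 1)"])
    show "0 \<le> \<bar>u x\<bar> \<and> \<bar>u x\<bar> \<le> M" for x using bd by simp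
    fix s t :: real assume st: "0 \<le> s" "s \<le> t" "t \<le> M"
    show "\<bar>t powr q - s powr q\<bar> \<le> q * M powr (q - 1) * (t - s)"
    proof (cases "s = t")
      case False
      hence "s < t" using st by simp
      have der: "((\<lambda>t. t powr q) has_real_derivative q * z powr (q - 1)) (at z)" if "s < z" for z
        using that st by (intro has_real_derivative_powr) auto
      have "continuous_on {s..t} (\<lambda>t. t powr q)"
        using st q by (intro continuous_on_powr' continuous_intros) auto
      from MVT[OF \<open>s < t\<close> this] der obtain l z where
        "s < z" "z < t" "((\<lambda>t. t powr q) has_real_derivative l) (at z)" "t powr q - s powr q = (t - s) * l"
        by (auto simp: real_differentiable_def)
      with DERIV_unique[OF this(3) der] obtain z where z: "s < z" "z < t" "t powr q - s powr q = (t - s) * (q * z powr (q - 1))" by auto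
      have "q * z powr (q - 1) \<le> q * M powr (q - 1)"
        using z st q by (intro mult_left_mono powr_mono2) auto
      hence "(t - s) * (q * z powr (q - 1)) \<le> (t - s) * (q * M powr (q - 1))"
        using st by (rule_tac mult_left_mono) auto
      moreover have "0 \<le> (t - s) * (q * z powr (q - 1))" using st q by simp
      ultimately show ?thesis unfolding z(3) by (metis abs_of_nonneg mult.commute)
    qed simp
  qed (use M in auto)
qed

text \<open>
  By polarization, squares of bounded members suffice.
\<close>

lemma mult_mem:
  assumes u: "u \<in> \<F>" "\<And>x. \<bar>u x\<bar> \<le> M" and v: "v \<in> \<F>" "\<And>x. \<bar>v x\<bar> \<le> M'"
  shows "(\<lambda>x. u x * v x) \<in> \<F>"
proof -
  have "(\<lambda>x. \<bar>u x + v x\<bar> powr 2) \<in> \<F>" "(\<lambda>x. \<bar>u x - v x\<bar> powr 2) \<in> \<F>"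
  proof -
    have "\<bar>u x + v x\<bar> \<le> M + M'" "\<bar>u x - v x\<bar> \<le> M + M'" for x using u(2)[of x] v(2)[of x] by linarith+
    then show "(\<lambda>x. \<bar>u x + v x\<bar> powr 2) \<in> \<F>" "(\<lambda>x. \<bar>u x - v x\<bar> powr 2) \<in> \<F>"
      by (intro abs_powr_mem[where M="M + M'"] add_mem diff_mem u v; simp)+
  qed
  from scale_mem[OF diff_mem[OF this], of "1/4"]
  show ?thesis by (simp add: power2_eq_square algebra_simps)
qed

text \<open>
  The generalized contraction property carries the two-point inequality from numbers to the form.
  The exponent \<open>r\<close> on the right exceeds \<open>1\<close>, which will make the second
  difference of \<open>t \<mapsto> form_norm (u + t v)\<close> of order \<open>t\<^sup>r =
  o(t)\<close>.
\<close>

lemma form_norm_second_difference: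
  obtains n :: nat and \<epsilon> r where "even n" "2 \<le> n" "0 < \<epsilon>" "1 < r" "r \<le> 2"
    "\<And>u v. u \<in> \<F> \<Longrightarrow> v \<in> \<F> \<Longrightarrow>
      form_norm (\<lambda>x. u x + \<epsilon> * v x) ^ n + form_norm (\<lambda>x. u x - \<epsilon> * v x) ^ n
        \<le> 2 * (form_norm u powr r + form_norm v powr r) powr (n / r)"
proof -
  \<comment> \<open>an even exponent above \<open>p\<close> makes the power of the sum a polynomial; \<open>\<epsilon>\<close> absorbs the constant \<open>4 ^ n\<close>
    of the two-point inequality, and \<open>c\<close> its factor \<open>2\<close>\<close>
  define n where "n = 2 * nat \<lceil>p\<rceil>"
  define r where "r = min p 2"
  define \<epsilon> where "\<epsilon> = 4 powr (- (n / r))"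
  define c where "c = (1 / 2) powr (1 / n)"
  have n: "even n" "2 \<le> n" "p \<le> n" using p_gt_1 unfolding n_def by (auto, linarith+)
  have r: "1 < r" "r \<le> 2" "r \<le> p" using p_gt_1 by (auto simp: r_def)
  have \<epsilon>: "0 < \<epsilon>" by (simp add: \<epsilon>_def)
  have c: "0 < c" "c ^ n = 1 / 2" using n by (simp_all add: c_def powr_realpow[symmetric] powr_powr)
  have \<epsilon>r: "4 ^ n * \<epsilon> powr r = 1"
  proof -
    have "\<epsilon> powr r = 4 powr (- real n)" using r by (simp add: \<epsilon>_def powr_powr)
    thus ?thesis by (simp add: powr_minus powr_realpow)
  qed
  define T :: "(nat \<Rightarrow> real) \<Rightarrow> nat \<Rightarrow> real" where
    "T = (\<lambda>x l. c * (x 0 + (if l = 0 then \<epsilon> else - \<epsilon>) * x 1))"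
  have lt2: "{..<2::nat} = {0, 1}" by auto
  have lqn: "lq_norm (ereal n) 2 a = ((a 0 ^ n + a 1 ^ n)) powr (1 / n)" for a
  proof -
    have "\<bar>t\<bar> powr n = t ^ n" for t :: real
      using n by (cases "t = 0") (simp_all add: powr_realpow power_even_abs power_0_left)
    thus ?thesis by (simp add: lq_norm_def lt2)
  qed
  have lqr: "lq_norm (ereal r) 2 a = (\<bar>a 0\<bar> powr r + \<bar>a 1\<bar> powr r) powr (1 / r)" for a
    by (simp add: lq_norm_def lt2)
  have T: "lq_norm (ereal n) 2 (\<lambda>l. T x l - T y l) \<le> lq_norm (ereal r) 2 (\<lambda>k. x k - y k)" for x y
  proof -
    define a b where "a = x 0 - y 0" and "b = \<epsilon> * (x 1 - y 1)"
    have "lq_norm (ereal n) 2 (\<lambda>l. T x l - T y l) = ((c * (a + b)) ^ n + (c * (a - b)) ^ n) powr (1 / n)"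
      unfolding lqn by (simp add: T_def a_def b_def algebra_simps)
    also have "\<dots> = (((a + b) ^ n + (a - b) ^ n) / 2) powr (1 / n)"
      by (simp add: power_mult_distrib c add_divide_distrib)
    also have "\<dots> \<le> ((\<bar>a\<bar> powr r + 4 ^ n * \<bar>b\<bar> powr r) powr (n / r)) powr (1 / n)"
      using two_point_inequality[of n r a b] n r
      by (intro powr_mono2) (auto simp: zero_le_even_power)
    also have "\<dots> = (\<bar>a\<bar> powr r + 4 ^ n * \<bar>b\<bar> powr r) powr (1 / r)"
      using n by (simp add: powr_powr)
    also have "4 ^ n * \<bar>b\<bar> powr r = \<bar>x 1 - y 1\<bar> powr r"
      using \<epsilon>r \<epsilon> by (simp add: b_def abs_mult powr_mult mult.assoc[symmetric])
    finally show ?thesis by (simp add: lqr a_def)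
  qed
  have main: "form_norm (\<lambda>x. u x + \<epsilon> * v x) ^ n + form_norm (\<lambda>x. u x - \<epsilon> * v x) ^ n
        \<le> 2 * (form_norm u powr r + form_norm v powr r) powr (n / r)" if uv: "u \<in> \<F>" "v \<in> \<F>" for u v
  proof -
    define w where "w k = (if k = 0 then u else v)" for k :: nat
    define N1 N2 where "N1 = form_norm (\<lambda>x. u x + \<epsilon> * v x)" and "N2 = form_norm (\<lambda>x. u x - \<epsilon> * v x)"
    have N: "N1 \<ge> 0" "N2 \<ge> 0" by (simp_all add: N1_def N2_def form_norm_nonneg)
    have mem: "(\<lambda>x. u x + \<epsilon> * v x) \<in> \<F>" "(\<lambda>x. u x - \<epsilon> * v x) \<in> \<F>"
      by (intro add_mem diff_mem scale_mem uv)+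
    have w: "\<forall>k<2. w k \<in> \<F>" using uv by (simp add: w_def)
    have "lq_norm (ereal n) 2 (\<lambda>l. form_norm (\<lambda>x. T (\<lambda>k. w k x) l))
        \<le> lq_norm (ereal r) 2 (\<lambda>k. form_norm (w k))"
      unfolding form_norm_def
      by (rule conjunct2[OF contraction[unfolded generalized_contraction_def, rule_format, of 2 2 "ereal r" "ereal n" T w]])
         (use n r T w in \<open>auto simp: T_def\<close>)
    also have "\<dots> = (form_norm u powr r + form_norm v powr r) powr (1 / r)"
      by (simp add: lqr w_def form_norm_nonneg)
    also have "(\<lambda>l. form_norm (\<lambda>x. T (\<lambda>k. w k x) l)) = (\<lambda>l. c * (if l = 0 then N1 else N2))"
      using form_norm_scale[OF mem(1), of c] form_norm_scale[OF mem(2), of c] c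
      by (auto simp: T_def w_def N1_def N2_def)
    also have "lq_norm (ereal n) 2 \<dots> = ((N1 ^ n + N2 ^ n) / 2) powr (1 / n)"
      unfolding lqn by (simp add: power_mult_distrib c add_divide_distrib)
    finally have le: "((N1 ^ n + N2 ^ n) / 2) powr (1 / n) \<le> (form_norm u powr r + form_norm v powr r) powr (1 / r)" .
    have "(N1 ^ n + N2 ^ n) / 2 = (((N1 ^ n + N2 ^ n) / 2) powr (1 / n)) powr n"
      using n N by (simp add: powr_powr)
    also have "\<dots> \<le> ((form_norm u powr r + form_norm v powr r) powr (1 / r)) powr n"
      using le by (intro powr_mono2) auto
    also have "\<dots> = (form_norm u powr r + form_norm v powr r) powr (n / r)"
      by (simp add: powr_powr)
    finally show ?thesis by (simp add: N1_def N2_def)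
  qed
  from that[OF n(1,2) \<epsilon> r(1,2) main] show ?thesis .
qed

text \<open>
  Convexity of \<open>t \<mapsto> form_norm (u + t v)\<close> at \<open>0\<close> between \<open>-
  s\<close> and \<open>t\<close>, with denominators cleared.
\<close>

lemma form_norm_convex_along_line:
  assumes uv: "u \<in> \<F>" "v \<in> \<F>" and st: "0 < s" "0 < t"
  shows "(s + t) * form_norm u \<le> t * form_norm (\<lambda>x. u x + (- s) * v x) + s * form_norm (\<lambda>x. u x + t * v x)"
proof -
  have "(s + t) * form_norm u = form_norm (\<lambda>x. (s + t) * u x)"
    using st by (simp add: form_norm_scale uv)
  also have "(\<lambda>x. (s + t) * u x) = (\<lambda>x. t * (u x + (- s) * v x) + s * (u x + t * v x))"
    by (simp add: algebra_simps)
  also have "form_norm \<dots> \<le> form_norm (\<lambda>x. t * (u x + (- s) * v x)) + form_norm (\<lambda>x. s * (u x + t * v x))"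
    by (intro form_norm_triangle scale_mem add_mem uv)
  also have "\<dots> = t * form_norm (\<lambda>x. u x + (- s) * v x) + s * form_norm (\<lambda>x. u x + t * v x)"
    using st by (simp only: form_norm_scale scale_mem add_mem uv abs_of_pos)
  finally show ?thesis .
qed

text \<open>
  The derivative in \<^const>\<open>form_deriv\<close> is additive over cells only if all the
  derivatives exist. Where the energy of \<open>u\<close> is positive, the norm itself is
  differentiable by the second difference estimate; where it vanishes, \<open>u\<close> is
  constant and the energy is a multiple of \<open>\<bar>t\<bar> powr p\<close>.
\<close>

lemma energy_differentiable:
  assumes uv: "u \<in> \<F>" "v \<in> \<F>"
  shows "(\<lambda>t. \<E> (\<lambda>x. u x + t * v x)) differentiable (at 0)"
proof (cases "\<E> u = 0")
  case True
  then obtain c where c: "u = (\<lambda>_. c)" using energy_eq_0_iff uv by blast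
  have "\<E> (\<lambda>x. u x + t * v x) = \<bar>t\<bar> powr p * \<E> v" for t
    using energy_add_const[OF scale_mem[OF uv(2)], of t c] energy_scale[OF uv(2)]
    by (simp add: c add.commute)
  moreover have "((\<lambda>t. \<bar>t\<bar> powr p * \<E> v) has_real_derivative 0) (at 0)"
  proof -
    have "((\<lambda>h::real. \<bar>h\<bar> powr (p - 1)) \<longlongrightarrow> 0) (at 0)"
      using p_gt_1 by (auto intro!: tendsto_eq_intros)
    hence "((\<lambda>h::real. \<bar>h\<bar> powr p / h) \<longlongrightarrow> 0) (at 0)"
    proof (rule Lim_null_comparison[rotated])
      have "norm (\<bar>h\<bar> powr p / h) \<le> \<bar>h\<bar> powr (p - 1)" for h :: real
        by (cases "h = 0") (auto simp: powr_diff)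
      thus "\<forall>\<^sub>F h in at 0. norm (\<bar>h\<bar> powr p / h) \<le> \<bar>h\<bar> powr (p - 1)" for h :: real by simp
    qed
    hence "((\<lambda>t::real. \<bar>t\<bar> powr p) has_real_derivative 0) (at 0)"
      by (simp add: has_field_derivative_iff)
    from DERIV_cmult_right[OF this] show ?thesis by simp
  qed
  ultimately show ?thesis by (auto simp: real_differentiable_def)
next
  case False
  define f where "f t = form_norm (\<lambda>x. u x + t * v x)" for t
  have mem: "(\<lambda>x. u x + t * v x) \<in> \<F>" for t by (intro add_mem scale_mem uv)
  have f0: "f 0 > 0" using False energy_nonneg[OF uv(1)] by (simp add: f_def form_norm_def)
  obtain n :: nat and \<epsilon> r where n: "even n" "2 \<le> n" and \<epsilon>: "0 < \<epsilon>" and r: "1 < r" "r \<le> 2" and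
    second: "\<And>u v. u \<in> \<F> \<Longrightarrow> v \<in> \<F> \<Longrightarrow>
      form_norm (\<lambda>x. u x + \<epsilon> * v x) ^ n + form_norm (\<lambda>x. u x - \<epsilon> * v x) ^ n
        \<le> 2 * (form_norm u powr r + form_norm v powr r) powr (n / r)"
    using form_norm_second_difference by blast
  define K where "K = (form_norm v / \<epsilon>) powr r * f 0 powr (1 - r)"
  have K: "K \<ge> 0" by (simp add: K_def)
  have gap: "f t + f (- t) - 2 * f 0 \<le> 2 * K * t powr r" if t: "0 < t" for t
  proof -
    have w: "(\<lambda>x. (t / \<epsilon>) * v x) \<in> \<F>" by (intro scale_mem uv)
    have fn: "0 \<le> f t" "0 \<le> f (- t)" by (simp_all add: f_def form_norm_nonneg)
    have "((f t + f (- t)) / 2) ^ n \<le> (f t ^ n + f (- t) ^ n) / 2"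
      using convex_onD[OF convex_power_even[OF n(1)], of "1/2" "f t" "f (- t)"]
      by (simp add: field_simps)
    also have "\<dots> \<le> (f 0 powr r + (t / \<epsilon> * form_norm v) powr r) powr (n / r)"
      using second[OF uv(1) w] form_norm_scale[OF uv(2), of "t / \<epsilon>"] t \<epsilon> by (simp add: f_def)
    also have "\<dots> = (f 0 powr r + f 0 powr r * (K / f 0 * t powr r)) powr (n / r)"
      using f0 t \<epsilon> by (simp add: K_def powr_mult powr_divide powr_diff form_norm_nonneg field_simps)
    also have "\<dots> = (f 0 powr r * (1 + K / f 0 * t powr r)) powr (n / r)"
      by (simp add: distrib_left)
    also have "\<dots> = (f 0 * (1 + K / f 0 * t powr r) powr (1 / r)) powr n"
      using r f0 by (simp add: powr_mult powr_powr)
    \<comment> \<open>\<open>(1 + z) powr (1 / r) \<le> 1 + z\<close> isolates the leading term \<open>f 0\<close>\<close>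
    also have "\<dots> \<le> (f 0 * (1 + K / f 0 * t powr r) powr 1) powr n"
      using r f0 K by (intro powr_mono2 mult_left_mono powr_mono) auto
    also have "\<dots> = (f 0 + K * t powr r) ^ n"
    proof -
      have "f 0 + K * t powr r > 0" using f0 K by (simp add: add_pos_nonneg)
      moreover have "f 0 * (1 + K / f 0 * t powr r) = f 0 + K * t powr r" using f0 by (simp add: distrib_left)
      moreover have "1 + K / f 0 * t powr r \<ge> 0" using f0 K by simp
      ultimately show ?thesis by (simp only: powr_one powr_realpow)
    qed
    finally have "(f t + f (- t)) / 2 \<le> f 0 + K * t powr r"
      using n f0 K by (subst (asm) power_mono_iff) (auto simp: fn)
    thus ?thesis by simp
  qed
  have "((\<lambda>t. 2 * K * t powr (r - 1)) \<longlongrightarrow> 2 * K * 0) (at_right 0)"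
    using r by (intro tendsto_intros) (auto intro!: tendsto_eq_intros simp: eventually_at_filter)
  moreover have "\<forall>\<^sub>F t in at_right 0. 2 * K * t powr (r - 1) = 2 * K * t powr r / t"
    by (auto simp: eventually_at_filter powr_diff)
  ultimately have "((\<lambda>t. 2 * K * t powr r / t) \<longlongrightarrow> 0) (at_right 0)"
    by (simp add: filterlim_cong)
  then have "f differentiable (at 0)"
    by (rule differentiable_at_0_if_second_difference_small[rotated 2])
       (use form_norm_convex_along_line[OF uv] gap in \<open>auto simp: f_def\<close>)
  then obtain D where "(f has_real_derivative D) (at 0)" by (auto simp: real_differentiable_def)
  from DERIV_powr[OF this f0 DERIV_const[of p]]
  have "(\<lambda>t. f t powr p) differentiable (at 0)" by (auto simp: real_differentiable_def)
  thus ?thesis by (simp add: f_def energy_eq mem)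
qed

end

section \<open>Words, cells and scales\<close>

primrec word_map :: "('s \<Rightarrow> 'a \<Rightarrow> 'a) \<Rightarrow> 's list \<Rightarrow> 'a \<Rightarrow> 'a" where
  "word_map F [] = id"
| "word_map F (i # w) = F i \<circ> word_map F w"

primrec word_append :: "'s list \<Rightarrow> (nat \<Rightarrow> 's) \<Rightarrow> nat \<Rightarrow> 's" where
  "word_append [] \<omega> = \<omega>"
| "word_append (i # w) \<omega> = prepend i (word_append w \<omega>)"

lemma word_append_apply:
  "word_append w \<omega> k = (if k < length w then w ! k else \<omega> (k - length w))"
  by (induction w arbitrary: k) (auto simp: prepend_def split: nat.split)

lemma shift_prepend [simp]: "shift (prepend i \<omega>) = \<omega>"
  by (simp add: shift_def prepend_def)

lemma funpow_shift_word_append: "(shift ^^ length w) (word_append w \<omega>) = \<omega>"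
  by (induction w) (auto simp: funpow_Suc_right simp del: funpow.simps(2))

lemma prepend_eq_iff [simp]: "prepend i \<omega> = prepend j \<tau> \<longleftrightarrow> i = j \<and> \<omega> = \<tau>"
proof
  assume eq: "prepend i \<omega> = prepend j \<tau>"
  from fun_cong[OF this, of 0] have "i = j" by (simp add: prepend_def)
  moreover from arg_cong[OF eq, of shift] have "\<omega> = \<tau>" by simp
  ultimately show "i = j \<and> \<omega> = \<tau>" by simp
qed simp

lemma prepend_shift: "prepend (\<omega> 0) (shift \<omega>) = \<omega>"
  by (auto simp: prepend_def shift_def split: nat.split)

text \<open>
  The coding map \<open>chi\<close> is a parameter so that words and infinite sequences can be related explicitly.
\<close>

locale self_similar_form = resistance_form p \<E> \<F>
  for p :: real and \<E> :: "('a::metric_space \<Rightarrow> real) \<Rightarrow> real" and \<F> :: "('a \<Rightarrow> real) set" +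
  fixes F :: "'s::finite \<Rightarrow> 'a \<Rightarrow> 'a" and \<rho> :: "'s \<Rightarrow> real" and chi :: "(nat \<Rightarrow> 's) \<Rightarrow> 'a"
  assumes self_similar_form: "self_similar_p_resistance_form F p \<rho> \<E> \<F>"
    and self_similar: "self_similar_structure F"
    and coding: "coding_map F chi"
    and \<rho>_gt_1: "\<rho> i > 1"
begin

text \<open>
  \<open>F i\<close> shrinks resistance distances at least by this factor.
\<close>

definition ratio :: "'s \<Rightarrow> real" where
  "ratio i = \<rho> i powr (- 1 / (p - 1))"

definition weight :: "'s list \<Rightarrow> real" where
  "weight w = prod_list (map \<rho> w)"

definition scale :: "'s list \<Rightarrow> real" where
  "scale w = prod_list (map ratio w)"

definition cell :: "'s list \<Rightarrow> 'a set" where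
  "cell w = range (word_map F w)"

text \<open>
  For \<open>s < 1\<close>, the words at which the product of the ratios, taken along the word,
  drops to \<open>s\<close> or below for the first time. Their cells cover the space and have
  resistance diameter at most of order \<open>s\<close>.
\<close>

definition words :: "real \<Rightarrow> 's list set" where
  "words s = {w. scale w \<le> s \<and> (w \<noteq> [] \<longrightarrow> s < scale (butlast w))}"

lemma word_simps [simp]:
  "weight [] = 1" "weight (i # w) = \<rho> i * weight w"
  "scale [] = 1" "scale (i # w) = ratio i * scale w"
  by (simp_all add: weight_def scale_def)

lemma compact_UNIV: "compact (UNIV :: 'a set)"
  and continuous_F: "continuous_on UNIV (F i)"
  and inj_F: "inj (F i)"
  using self_similar by (auto simp: self_similar_structure_def)

lemma continuous_chi: 
    "continuous_map (product_topology (\<lambda>_::nat. discrete_topology (UNIV::'s set)) UNIV) euclidean chi"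
  and surj_chi: "surj chi"
  and F_chi: "F i (chi \<omega>) = chi (prepend i \<omega>)"
  using coding by (auto simp: coding_map_def fun_eq_iff)

lemma mem_iff: "u \<in> \<F> \<longleftrightarrow> continuous_on UNIV u \<and> (\<forall>i. u \<circ> F i \<in> \<F>)"
proof -
  have "\<F> = {u. continuous_on UNIV u \<and> (\<forall>i. u \<circ> F i \<in> \<F>)}"
    using self_similar_form unfolding self_similar_p_resistance_form_def by (elim conjE)
  from arg_cong[OF this, of "\<lambda>A. u \<in> A"] show ?thesis unfolding mem_Collect_eq .
qed

lemma mem_continuous: "u \<in> \<F> \<Longrightarrow> continuous_on UNIV u"
  and comp_F_mem: "u \<in> \<F> \<Longrightarrow> u \<circ> F i \<in> \<F>"
  by (simp_all add: mem_iff[of u])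

lemma energy_split: "u \<in> \<F> \<Longrightarrow> \<E> u = (\<Sum>i\<in>UNIV. \<rho> i * \<E> (u \<circ> F i))"
  using self_similar_form unfolding self_similar_p_resistance_form_def by (elim conjE) simp

lemma mem_bounded: "u \<in> \<F> \<Longrightarrow> \<exists>M. \<forall>x. \<bar>u x\<bar> \<le> M"
  using compact_imp_bounded[OF compact_continuous_image[OF mem_continuous compact_UNIV]]
  by (auto simp: bounded_iff)

lemma bounded_mult_mem: "u \<in> \<F> \<Longrightarrow> v \<in> \<F> \<Longrightarrow> (\<lambda>x. u x * v x) \<in> \<F>"
  using mem_bounded[of u] mem_bounded[of v] mult_mem by blast

lemma weight_pos: "weight w > 0"
  by (induction w) (auto intro!: mult_pos_pos less_trans[OF _ \<rho>_gt_1])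

lemma ratio_pos: "ratio i > 0"
  using \<rho>_gt_1[of i] by (simp add: ratio_def)

lemma ratio_less_1: "ratio i < 1"
  using \<rho>_gt_1[of i] p_gt_1 by (simp add: ratio_def powr_less_one)

lemma scale_pos: "scale w > 0"
  by (induction w) (auto simp: ratio_pos)

lemma scale_le_1: "scale w \<le> 1"
  by (induction w) (use ratio_pos ratio_less_1 scale_pos in \<open>auto intro!: mult_le_one simp: less_imp_le\<close>)

lemma scale_eq: "scale w = weight w powr (- 1 / (p - 1))"
  using \<rho>_gt_1 by (induction w) (auto simp: ratio_def powr_mult)

lemma weight_eq: "weight w = scale w powr (- (p - 1))"
proof -
  have "(- 1 / (p - 1)) * (- (p - 1)) = 1" using p_gt_1 by (simp add: field_simps)
  thus ?thesis using weight_pos[of w] by (simp only: scale_eq powr_powr powr_one)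
qed

definition min_ratio :: real where "min_ratio = Min (range ratio)"

lemma min_ratio: "0 < min_ratio" "min_ratio \<le> ratio i" "min_ratio < 1"
proof -
  show "0 < min_ratio" "min_ratio \<le> ratio i" using ratio_pos by (auto simp: min_ratio_def)
  thus "min_ratio < 1" using ratio_less_1[of i] by linarith
qed

lemma words_ge_1:
  assumes "1 \<le> s" shows "words s = {[]}"
proof -
  have "\<not> s < scale w" for w using scale_le_1[of w] assms by linarith
  thus ?thesis using assms by (auto simp: words_def)
qed

lemma words_less_1:
  assumes "0 < s" "s < 1"
  shows "words s = (\<Union>i. (#) i ` words (s / ratio i))"
proof -
  have "i # w \<in> words s \<longleftrightarrow> w \<in> words (s / ratio i)" for i w
    using assms ratio_pos[of i] by (cases "w = []") (simp_all add: words_def field_simps)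
  moreover have "[] \<notin> words s" using assms by (simp add: words_def)
  ultimately have "w \<in> words s \<longleftrightarrow> w \<in> (\<Union>i. (#) i ` words (s / ratio i))" for w
    by (cases w) auto
  thus ?thesis by blast
qed

text \<open>
  Passing from a scale \<open>s < 1\<close> to the first level subcells replaces \<open>s\<close>
  by \<open>s / ratio i\<close>, which is larger by a factor bounded away from \<open>1\<close>;
  scale \<open>1\<close> is reached after finitely many steps. The rule plays the part of an
  induction over the tree of words above the partition \<open>words s\<close>.
\<close>

lemma scale_induct [consumes 1, case_names large small]:
  fixes s :: real
  assumes s: "0 < s" and large: "\<And>s. 1 \<le> s \<Longrightarrow> P s"
    and small: "\<And>s. 0 < s \<Longrightarrow> s < 1 \<Longrightarrow> (\<And>i. P (s / ratio i)) \<Longrightarrow> P s"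
  shows "P s"
proof -
  define R where "R = Max (range ratio)"
  have R: "ratio i \<le> R" "R < 1" for i using ratio_less_1 by (simp_all add: R_def)
  have "0 < R" using less_le_trans[OF ratio_pos R(1)] .
  have "P s" if "0 < s" "R ^ n \<le> s" for n
    using that
  proof (induction n arbitrary: s)
    case 0 thus ?case using large by simp
  next
    case (Suc n)
    show ?case
    proof (cases "1 \<le> s")
      case False
      have "R ^ n \<le> s / ratio i" for i
      proof -
        have "ratio i * R ^ n \<le> R * R ^ n" using R(1) \<open>0 < R\<close> by (intro mult_right_mono) auto
        thus ?thesis using Suc.prems ratio_pos[of i] by (simp add: field_simps)
      qed
      hence "P (s / ratio i)" for i using Suc ratio_pos by simp
      thus ?thesis using False Suc.prems by (simp add: small)
    qed (rule large)
  qed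
  moreover obtain n where "R ^ n < s" using real_arch_pow_inv[OF s R(2)] by blast
  ultimately show ?thesis using s less_imp_le by blast
qed

lemma finite_words: "0 < s \<Longrightarrow> finite (words s)"
  by (induction s rule: scale_induct) (auto simp: words_ge_1 words_less_1)

lemma sum_words:
  assumes "0 < s" "s < 1"
  shows "(\<Sum>w\<in>words s. f w) = (\<Sum>i\<in>UNIV. \<Sum>w\<in>words (s / ratio i). f (i # w))"
proof -
  have "(\<Sum>w\<in>words s. f w) = (\<Sum>i\<in>UNIV. \<Sum>w\<in>(#) i ` words (s / ratio i). f w)"
    unfolding words_less_1[OF assms] 
    using assms ratio_pos finite_words by (intro sum.UNION_disjoint) auto
  thus ?thesis by (simp add: sum.reindex)
qed

lemma scale_words_le: "w \<in> words s \<Longrightarrow> scale w \<le> s"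
  by (simp add: words_def)

lemma scale_words_ge: "0 < s \<Longrightarrow> s \<le> 1 \<Longrightarrow> w \<in> words s \<Longrightarrow> min_ratio * s \<le> scale w"
proof (induction s arbitrary: w rule: scale_induct)
  case (large s)
  thus ?case using min_ratio by (simp add: words_ge_1)
next
  case (small s)
  then obtain i v where w: "w = i # v" "v \<in> words (s / ratio i)" by (auto simp: words_less_1)
  show ?case
  proof (cases "s / ratio i \<le> 1")
    case True
    from small.IH[OF this w(2)] show ?thesis using ratio_pos[of i] by (simp add: w(1) field_simps)
  next
    case False
    hence "v = []" using w(2) by (simp add: words_ge_1)
    moreover have "min_ratio * s \<le> min_ratio * 1" using small min_ratio by (intro mult_left_mono) auto
    ultimately show ?thesis using min_ratio(2)[of i] by (simp add: w(1))
  qed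
qed

text \<open>
  The factor by which the oscillation, to the power \<open>p\<close>, of a function of given
  energy shrinks on a cell of scale \<open>s\<close>.
\<close>

lemma inverse_weight_words_le:
  assumes "w \<in> words s" shows "1 / weight w \<le> s powr (p - 1)"
proof -
  have "1 / weight w = scale w powr (p - 1)" unfolding weight_eq powr_minus by (simp add: divide_inverse)
  also have "\<dots> \<le> s powr (p - 1)"
    using p_gt_1 scale_pos[of w] scale_words_le[OF assms] by (intro powr_mono2) auto
  finally show ?thesis .
qed

lemma weight_words_le:
  assumes "0 < s" "s \<le> 1" "w \<in> words s" shows "weight w \<le> (min_ratio * s) powr (- (p - 1))"
  using p_gt_1 min_ratio scale_words_ge[OF assms] assms
  by (simp add: weight_eq) (intro powr_mono2', auto)

lemma range_F_cover: "\<exists>i y. x = F i y"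
proof -
  obtain \<omega> where "x = chi \<omega>" using surj_chi by blast
  hence "x = F (\<omega> 0) (chi (shift \<omega>))" by (simp add: F_chi prepend_shift)
  thus ?thesis by blast
qed

lemma word_map_chi: "word_map F w (chi \<omega>) = chi (word_append w \<omega>)"
  by (induction w) (auto simp: F_chi)

lemma continuous_word_map: "continuous_on UNIV (word_map F w)"
proof (induction w)
  case (Cons i w)
  have "continuous_on UNIV (F i \<circ> word_map F w)"
    by (rule continuous_on_compose[OF Cons continuous_on_subset[OF continuous_F]]) simp
  thus ?case by simp
qed (simp add: id_def)

lemma inj_word_map: "inj (word_map F w)"
  by (induction w) (auto intro: inj_compose[OF inj_F, unfolded comp_def])

lemma compact_cell: "compact (cell w)"
  unfolding cell_def by (intro compact_continuous_image continuous_word_map compact_UNIV)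

lemma cell_cover: "0 < s \<Longrightarrow> \<exists>w\<in>words s. x \<in> cell w"
proof (induction s arbitrary: x rule: scale_induct)
  case (small s)
  obtain i y where x: "x = F i y" using range_F_cover by blast
  from small.IH obtain w where "w \<in> words (s / ratio i)" "y \<in> cell w" by blast
  thus ?case using small.hyps by (intro bexI[of _ "i # w"]) (auto simp: words_less_1 x cell_def)
qed (simp add: words_ge_1 cell_def)

lemma comp_word_map_mem: "u \<in> \<F> \<Longrightarrow> u \<circ> word_map F w \<in> \<F>"
  by (induction w arbitrary: u) (auto simp: o_assoc comp_F_mem)

lemma energy_sum_words:
  "0 < s \<Longrightarrow> u \<in> \<F> \<Longrightarrow> \<E> u = (\<Sum>w\<in>words s. weight w * \<E> (u \<circ> word_map F w))"
proof (induction s arbitrary: u rule: scale_induct)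
  case (small s)
  have "\<E> u = (\<Sum>i\<in>UNIV. \<rho> i * \<E> (u \<circ> F i))" by (rule energy_split) fact
  also have "\<dots> = (\<Sum>i\<in>UNIV. \<rho> i * (\<Sum>w\<in>words (s / ratio i). weight w * \<E> (u \<circ> F i \<circ> word_map F w)))"
    using small by (intro sum.cong refl arg_cong2[where f="(*)"] small.IH comp_F_mem)
  finally show ?case using small.hyps by (simp add: sum_words sum_distrib_left comp_def mult.assoc)
qed (simp add: words_ge_1)

lemma weighted_energy_nonneg: "u \<in> \<F> \<Longrightarrow> 0 \<le> weight w * \<E> (u \<circ> word_map F w)"
  using weight_pos[of w] energy_nonneg[OF comp_word_map_mem] by simp

section \<open>Oscillation on cells\<close>

text \<open>
  Finiteness of the resistance between two fixed points.
\<close>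

lemma point_resistance:
  obtains C where "0 \<le> C" "\<And>u. u \<in> \<F> \<Longrightarrow> \<bar>u x - u y\<bar> \<le> C * form_norm u"
proof -
  define R where "R = enn2real (p_resistance p \<E> \<F> x y)"
  have "\<bar>u x - u y\<bar> \<le> R powr (1 / p) * form_norm u" if u: "u \<in> \<F>" for u
  proof (cases "u \<in> range (\<lambda>c _. c)")
    case False
    hence pos: "\<E> u > 0" using energy_eq_0_iff[OF u] energy_nonneg[OF u] by (force simp: less_le)
    have "ennreal (\<bar>u x - u y\<bar> powr p / \<E> u) \<le> p_resistance p \<E> \<F> x y"
      unfolding p_resistance_def using u False by (intro SUP_upper) auto
    also have "\<dots> = ennreal R" using p_resistance_finite[of x y] by (simp add: R_def)
    finally have "\<bar>u x - u y\<bar> powr p \<le> R * \<E> u"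
      using pos by (simp add: R_def field_simps)
    hence "(\<bar>u x - u y\<bar> powr p) powr (1 / p) \<le> (R * \<E> u) powr (1 / p)"
      using p_gt_1 by (intro powr_mono2) auto
    thus ?thesis using p_gt_1 by (simp add: powr_powr powr_mult form_norm_def)
  qed (auto simp: form_norm_nonneg)
  thus ?thesis by (intro that[of "R powr (1 / p)"]) auto
qed

text \<open>
  The words \<open>\<omega>\<^sub>0 \<dots> \<omega>\<^sub>n\<^sub>-\<^sub>1 \<tau>\<close>
  converge to \<open>\<omega>\<close> in the product topology, whatever the tail
  \<open>\<tau>\<close> is.
\<close>

lemma word_map_tendsto:
  "(\<lambda>n. word_map F (map \<omega> [0..<n]) x) \<longlonglongrightarrow> chi \<omega>"
proof -
  obtain \<tau> where \<tau>: "x = chi \<tau>" using surj_chi by blast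
  have "limitin (product_topology (\<lambda>_::nat. discrete_topology (UNIV::'s set)) UNIV)
     (\<lambda>n. word_append (map \<omega> [0..<n]) \<tau>) \<omega> sequentially"
  proof (subst limitin_componentwise, intro conjI ballI)
    fix k :: nat
    have "\<forall>\<^sub>F n in sequentially. word_append (map \<omega> [0..<n]) \<tau> k = \<omega> k"
      using eventually_gt_at_top[of k] by eventually_elim (simp add: word_append_apply)
    thus "limitin (discrete_topology UNIV) (\<lambda>n. word_append (map \<omega> [0..<n]) \<tau> k) (\<omega> k) sequentially"
      unfolding limitin_def by (auto elim: eventually_mono)
  qed auto
  from continuous_map_limit[OF continuous_chi this]
  show ?thesis by (simp add: \<tau> word_map_chi o_def limitin_canonical_iff)
qed

lemma form_norm_comp_F_le:
  assumes u: "u \<in> \<F>" shows "form_norm (u \<circ> F i) \<le> \<rho> i powr (- 1 / p) * form_norm u"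
proof -
  have "\<rho> i * \<E> (u \<circ> F i) \<le> \<E> u"
    unfolding energy_split[OF u] using \<rho>_gt_1 u less_imp_le[OF less_trans[OF zero_less_one \<rho>_gt_1]]
    by (intro member_le_sum mult_nonneg_nonneg energy_nonneg comp_F_mem) auto
  hence "\<E> (u \<circ> F i) \<le> \<E> u / \<rho> i" using \<rho>_gt_1[of i] by (simp add: field_simps)
  hence "form_norm (u \<circ> F i) \<le> (\<E> u / \<rho> i) powr (1 / p)"
    unfolding form_norm_def using p_gt_1 energy_nonneg comp_F_mem[OF u] by (intro powr_mono2) auto
  also have "\<dots> = \<rho> i powr (- 1 / p) * form_norm u"
    by (simp add: form_norm_def powr_divide powr_minus_divide)
  finally show ?thesis .
qed

text \<open>
  The resistance is bounded on all pairs of points. The finitely many resistances between a base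
  point \<open>x0\<close> and its images \<open>F i x0\<close> bound the first step of the chain
  \<open>x0, F\<^sub>w\<^sub>1 x0, F\<^sub>w\<^sub>1 F\<^sub>w\<^sub>2 x0, \<dots>\<close>; on
  each further level the energy loses a factor of at least \<open>Min \<rho> > 1\<close>, so the
  steps add up to a convergent geometric series. The images of \<open>x0\<close> under all words
  are dense.
\<close>

lemma oscillation_bound:
  obtains D where "0 < D" "\<And>u x y. u \<in> \<F> \<Longrightarrow> \<bar>u x - u y\<bar> \<le> D * form_norm u"
proof -
  fix x0 :: 'a
  have "\<forall>i. \<exists>C\<ge>0. \<forall>u\<in>\<F>. \<bar>u (F i x0) - u x0\<bar> \<le> C * form_norm u"
    using point_resistance by metis
  then obtain C where C: "\<And>i. C i \<ge> 0" "\<And>i u. u \<in> \<F> \<Longrightarrow> \<bar>u (F i x0) - u x0\<bar> \<le> C i * form_norm u"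
    by metis
  define C0 where "C0 = sum C UNIV"
  have C0: "C i \<le> C0" "0 \<le> C0" for i 
    unfolding C0_def using C(1) by (auto intro!: member_le_sum sum_nonneg)
  define \<kappa> where "\<kappa> = Max (range (\<lambda>i. \<rho> i powr (- 1 / p)))"
  have \<kappa>: "\<rho> i powr (- 1 / p) \<le> \<kappa>" "\<kappa> < 1" for i
    using \<rho>_gt_1 p_gt_1 by (auto simp: \<kappa>_def powr_less_one)
  define C1 where "C1 = C0 / (1 - \<kappa>)"
  have C1: "0 \<le> C1" "C1 * \<kappa> + C0 = C1" using C0 \<kappa> by (auto simp: C1_def field_simps)
  have word: "\<bar>u (word_map F w x0) - u x0\<bar> \<le> C1 * form_norm u" if "u \<in> \<F>" for u w
    using that
  proof (induction w arbitrary: u)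
    case (Cons i w)
    have "\<bar>u (word_map F (i # w) x0) - u x0\<bar>
       \<le> \<bar>(u \<circ> F i) (word_map F w x0) - (u \<circ> F i) x0\<bar> + \<bar>u (F i x0) - u x0\<bar>" by simp
    also have "\<dots> \<le> C1 * form_norm (u \<circ> F i) + C0 * form_norm u"
    proof (intro add_mono Cons.IH comp_F_mem Cons.prems)
      show "\<bar>u (F i x0) - u x0\<bar> \<le> C0 * form_norm u"
        using order_trans[OF C(2)[OF Cons.prems] mult_right_mono[OF C0(1) form_norm_nonneg]] .
    qed
    also have "C1 * form_norm (u \<circ> F i) \<le> C1 * (\<kappa> * form_norm u)"
      using order_trans[OF form_norm_comp_F_le[OF Cons.prems] mult_right_mono[OF \<kappa>(1) form_norm_nonneg]] C1
      by (intro mult_left_mono)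
    also have "C1 * (\<kappa> * form_norm u) + C0 * form_norm u = (C1 * \<kappa> + C0) * form_norm u"
      by (simp add: algebra_simps)
    finally show ?case using C1 by simp
  qed (use C1 form_norm_nonneg in auto)
  have all: "\<bar>u x - u x0\<bar> \<le> C1 * form_norm u" if u: "u \<in> \<F>" for u x
  proof -
    obtain \<omega> where \<omega>: "x = chi \<omega>" using surj_chi by blast
    have "isCont u x" using mem_continuous[OF u] by (simp add: continuous_on_eq_continuous_at)
    from isCont_tendsto_compose[OF this word_map_tendsto[of \<omega> x0, folded \<omega>]]
    have "(\<lambda>n. \<bar>u (word_map F (map \<omega> [0..<n]) x0) - u x0\<bar>) \<longlonglongrightarrow> \<bar>u x - u x0\<bar>"
      by (intro tendsto_intros)
    thus ?thesis by (rule LIMSEQ_le_const2) (use word[OF u] in auto)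
  qed
  show ?thesis
  proof (rule that[of "2 * C1 + 1"])
    fix u x y assume u: "u \<in> \<F>"
    have "\<bar>u x - u y\<bar> \<le> 2 * C1 * form_norm u" using all[OF u, of x] all[OF u, of y] by linarith
    also have "\<dots> \<le> (2 * C1 + 1) * form_norm u" by (simp add: form_norm_nonneg distrib_right)
    finally show "\<bar>u x - u y\<bar> \<le> (2 * C1 + 1) * form_norm u" .
  qed (use C1 in auto)
qed

lemma cell_oscillation_bound:
  obtains D where "0 < D" "\<And>u w x y. u \<in> \<F> \<Longrightarrow> x \<in> cell w \<Longrightarrow> y \<in> cell w \<Longrightarrow>
     \<bar>u x - u y\<bar> powr p \<le> D * \<E> (u \<circ> word_map F w)"
proof -
  obtain D where D: "0 < D" "\<And>u x y. u \<in> \<F> \<Longrightarrow> \<bar>u x - u y\<bar> \<le> D * form_norm u"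
    using oscillation_bound by blast
  show ?thesis
  proof (rule that[of "D powr p"])
    fix u w x y assume u: "u \<in> \<F>" and "x \<in> cell w" "y \<in> cell w"
    then obtain a b where x: "x = word_map F w a" "y = word_map F w b" by (auto simp: cell_def)
    have "\<bar>u x - u y\<bar> \<le> D * form_norm (u \<circ> word_map F w)"
      using D(2)[OF comp_word_map_mem[OF u], of w a b] by (simp add: x)
    hence "\<bar>u x - u y\<bar> powr p \<le> (D * form_norm (u \<circ> word_map F w)) powr p"
      using p_gt_1 by (intro powr_mono2) auto
    also have "\<dots> = D powr p * \<E> (u \<circ> word_map F w)"
      using D by (simp add: powr_mult energy_eq[OF comp_word_map_mem[OF u]])
    finally show "\<bar>u x - u y\<bar> powr p \<le> D powr p * \<E> (u \<circ> word_map F w)" .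
  qed (use D in auto)
qed

text \<open>
  Otherwise there would be two distinct points \<open>a\<close>, \<open>b\<close> that are limits
  of pairs lying in common cells of ever smaller scale. The oscillation of a fixed \<open>u \<in>
  \<F>\<close> on such cells tends to \<open>0\<close>, so \<open>u a = u b\<close> for all
  \<open>u \<in> \<F>\<close>, against the separation of points.
\<close>

lemma small_cells:
  assumes "0 < e"
  obtains s0 where "0 < s0" "\<And>s w x y. 0 < s \<Longrightarrow> s \<le> s0 \<Longrightarrow> w \<in> words s \<Longrightarrow> x \<in> cell w \<Longrightarrow> y \<in> cell w \<Longrightarrow> dist x y < e"
proof (rule ccontr)
  assume "\<not> thesis"
  have "\<exists>s w x y. 0 < s \<and> s \<le> 1 / real (Suc n) \<and> w \<in> words s \<and> x \<in> cell w \<and> y \<in> cell w \<and> e \<le> dist x y" for n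
    using that[of "1 / real (Suc n)"] \<open>\<not> thesis\<close> by (force simp: not_less)
  then obtain s w x y where *: "\<And>n. 0 < s n" "\<And>n. s n \<le> 1 / real (Suc n)" "\<And>n. w n \<in> words (s n)"
    "\<And>n. x n \<in> cell (w n)" "\<And>n. y n \<in> cell (w n)" "\<And>n. e \<le> dist (x n) (y n)" by metis
  have "compact (UNIV \<times> UNIV :: ('a \<times> 'a) set)" by (intro compact_Times compact_UNIV)
  then obtain l \<phi> where \<phi>: "strict_mono (\<phi> :: nat \<Rightarrow> nat)" and "((\<lambda>n. (x n, y n)) \<circ> \<phi>) \<longlonglongrightarrow> l"
    unfolding compact_def by (metis UNIV_Times_UNIV UNIV_I)
  then obtain a b where ab: "(\<lambda>n. (x (\<phi> n), y (\<phi> n))) \<longlonglongrightarrow> (a, b)" by (cases l) (auto simp: o_def)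
  have x: "(\<lambda>n. x (\<phi> n)) \<longlonglongrightarrow> a" and y: "(\<lambda>n. y (\<phi> n)) \<longlonglongrightarrow> b"
    using tendsto_fst[OF ab] tendsto_snd[OF ab] by simp_all
  have "e \<le> dist a b" using tendsto_dist[OF x y] by (rule LIMSEQ_le_const) (use * in auto)
  hence "a \<noteq> b" using assms by auto
  then obtain u where u: "u \<in> \<F>" "u a \<noteq> u b" using separates_points by blast
  obtain D where D: "0 < D" "\<And>u w x y. u \<in> \<F> \<Longrightarrow> x \<in> cell w \<Longrightarrow> y \<in> cell w \<Longrightarrow>
     \<bar>u x - u y\<bar> powr p \<le> D * \<E> (u \<circ> word_map F w)" using cell_oscillation_bound by blast
  have bound: "\<bar>u (x n) - u (y n)\<bar> powr p \<le> D * \<E> u * (1 / real (Suc n)) powr (p - 1)" for n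
  proof -
    have "weight (w n) * \<E> (u \<circ> word_map F (w n)) \<le> \<E> u"
      unfolding energy_sum_words[OF *(1)[of n] u(1)] using *(1,3)
      by (intro member_le_sum weighted_energy_nonneg u finite_words) auto
    hence "\<E> (u \<circ> word_map F (w n)) \<le> \<E> u * (1 / weight (w n))"
      using weight_pos[of "w n"] by (simp add: field_simps)
    also have "\<dots> \<le> \<E> u * (1 / real (Suc n)) powr (p - 1)"
      using order_trans[OF inverse_weight_words_le[OF *(3)[of n]] powr_mono2[OF _ _ *(2)[of n]]] *(1)[of n] p_gt_1
      by (intro mult_left_mono energy_nonneg u) auto
    finally have "D * \<E> (u \<circ> word_map F (w n)) \<le> D * (\<E> u * (1 / real (Suc n)) powr (p - 1))"
      using D by simp
    thus ?thesis using order_trans[OF D(2)[OF u(1) *(4,5)]] by (simp add: mult.assoc)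
  qed
  have cont: "isCont u z" for z using mem_continuous[OF u(1)] by (simp add: continuous_on_eq_continuous_at)
  have "(\<lambda>n. \<bar>u (x (\<phi> n)) - u (y (\<phi> n))\<bar> powr p) \<longlonglongrightarrow> \<bar>u a - u b\<bar> powr p"
    using u(2) by (intro tendsto_intros isCont_tendsto_compose[OF cont] x y) auto
  moreover have "(\<lambda>n. \<bar>u (x (\<phi> n)) - u (y (\<phi> n))\<bar> powr p) \<longlonglongrightarrow> 0"
  proof (rule Lim_null_comparison)
    show "\<forall>\<^sub>F n in sequentially. norm (\<bar>u (x (\<phi> n)) - u (y (\<phi> n))\<bar> powr p) \<le> D * \<E> u * (1 / real (Suc (\<phi> n))) powr (p - 1)"
      using bound by auto
    have "(\<lambda>n. D * \<E> u * (1 / real (Suc n)) powr (p - 1)) \<longlonglongrightarrow> D * \<E> u * 0"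
      using p_gt_1 LIMSEQ_inverse_real_of_nat
      by (intro tendsto_intros tendsto_zero_powrI[where b="p - 1"]) (auto simp: inverse_eq_divide)
    from LIMSEQ_subseq_LIMSEQ[OF this \<phi>]
    show "(\<lambda>n. D * \<E> u * (1 / real (Suc (\<phi> n))) powr (p - 1)) \<longlonglongrightarrow> 0" by (simp add: o_def)
  qed
  ultimately have "\<bar>u a - u b\<bar> powr p = 0" by (rule LIMSEQ_unique)
  thus False using u(2) by simp
qed

end

context self_similar_form begin

section \<open>Cutoff functions and gluing\<close>

text \<open>
  As \<open>\<F>\<close> is an algebra that separates points, it contains a function close to a
  continuous Urysohn function; a piecewise linear map then straightens its values to exactly
  \<open>0\<close> and \<open>1\<close>.
\<close>

lemma cutoff:
  assumes "closed A" "closed B" "A \<inter> B = {}"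
  obtains \<phi> where "\<phi> \<in> \<F>" "\<And>x. 0 \<le> \<phi> x" "\<And>x. \<phi> x \<le> 1"
    "\<And>x. x \<in> A \<Longrightarrow> \<phi> x = 1" "\<And>x. x \<in> B \<Longrightarrow> \<phi> x = 0"
proof -
  have "normal_space (euclidean :: 'a topology)"
    by (intro metrizable_imp_normal_space metrizable_space_euclidean)
  then obtain f :: "'a \<Rightarrow> real" where "continuous_map euclidean euclideanreal f" "f ` A \<subseteq> {1}" "f ` B \<subseteq> {0}"
    using assms by (auto simp: disjnt_def elim!: Urysohn_lemma_alt[where a=1 and b=0 and S=A and T=B])
  hence f: "continuous_on UNIV f" "\<And>x. x \<in> A \<Longrightarrow> f x = 1" "\<And>x. x \<in> B \<Longrightarrow> f x = 0" by auto
  have "\<exists>g. g \<in> \<F> \<and> (\<forall>x\<in>UNIV. \<bar>f x - g x\<bar> < 1 / 4)"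
    by (rule Stone_Weierstrass_HOL[where P="\<lambda>g. g \<in> \<F>"])
       (use f compact_UNIV const_mem mem_continuous add_mem bounded_mult_mem separates_points in \<open>auto simp: Bex_def[symmetric]\<close>)
  then obtain g where g: "g \<in> \<F>" "\<And>x. \<bar>f x - g x\<bar> < 1 / 4" by auto
  \<comment> \<open>\<open>k\<close> sends \<open>(-\<infinity>, 1/4]\<close> to \<open>0\<close> and \<open>[3/4, \<infinity>)\<close> to \<open>1\<close>\<close>
  define k where "k t = max 0 (min 1 (2 * t - 1 / 2))" for t :: real
  have "(\<lambda>x. k (g x)) \<in> \<F>"
    by (rule lipschitz_comp_mem[OF g(1), where L=2]) (simp add: k_def abs_if max_def min_def)
  moreover have "k (g x) = 1" if "x \<in> A" for x
  proof -
    have "3 / 4 \<le> g x" using g(2)[of x] f(2)[OF that] by linarith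
    thus ?thesis by (simp add: k_def)
  qed
  moreover have "k (g x) = 0" if "x \<in> B" for x
  proof -
    have "g x \<le> 1 / 4" using g(2)[of x] f(3)[OF that] by linarith
    thus ?thesis by (simp add: k_def)
  qed
  ultimately show ?thesis by (intro that[of "\<lambda>x. k (g x)"]) (auto simp: k_def)
qed

text \<open>
  Gluing is continuous because the sets \<open>F i ` UNIV\<close> form a finite closed cover of a
  compact space, and the glued function is in \<open>\<F>\<close> by the self-similarity of the
  domain.
\<close>

lemma glue_level_one:
  assumes u: "\<And>i. u i \<in> \<F>" and compat: "\<And>i j a b. F i a = F j b \<Longrightarrow> u i a = u j b"
  obtains v where "v \<in> \<F>" "\<And>i. v \<circ> F i = u i"
proof -
  obtain I Y where IY: "\<And>x. x = F (I x) (Y x)" using range_F_cover by metis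
  define v where "v x = u (I x) (Y x)" for x
  have comp: "v \<circ> F i = u i" for i
    using compat[OF IY[of "F i _", symmetric]] by (auto simp: v_def fun_eq_iff)
  have "closed (v -` C)" if C: "closed C" for C
  proof -
    have "v -` C = (\<Union>i. F i ` (u i -` C))"
    proof (intro equalityI subsetI)
      fix x assume "x \<in> v -` C"
      hence "Y x \<in> u (I x) -` C" by (simp add: v_def)
      thus "x \<in> (\<Union>i. F i ` (u i -` C))" using IY[of x] by blast
    next
      fix x assume "x \<in> (\<Union>i. F i ` (u i -` C))"
      then obtain i y where "x = F i y" "u i y \<in> C" by blast
      thus "x \<in> v -` C" using fun_cong[OF comp[of i], of y] by simp
    qed
    moreover have "compact (F i ` (u i -` C))" for i
    proof -
      have "closed (u i -` C \<inter> UNIV)"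
        using mem_continuous[OF u] C continuous_on_closed_vimage[OF closed_UNIV] by blast
      hence "compact (u i -` C)" using closed_Int_compact[OF _ compact_UNIV] by simp
      thus ?thesis using continuous_on_subset[OF continuous_F] by (intro compact_continuous_image) auto
    qed
    ultimately show ?thesis by (auto intro!: closed_UN compact_imp_closed)
  qed
  hence "continuous_on UNIV v" by (simp add: continuous_on_closed_vimage)
  hence "v \<in> \<F>" using u by (simp add: mem_iff[of v] comp)
  with that comp show ?thesis by blast
qed

lemma glue:
  assumes "0 < s" and "\<And>w. w \<in> words s \<Longrightarrow> \<psi> w \<in> \<F>"
    and "\<And>v w a b. v \<in> words s \<Longrightarrow> w \<in> words s \<Longrightarrow> word_map F v a = word_map F w b \<Longrightarrow> \<psi> v a = \<psi> w b"
  shows "\<exists>u\<in>\<F>. \<forall>w\<in>words s. u \<circ> word_map F w = \<psi> w"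
  using assms
proof (induction s arbitrary: \<psi> rule: scale_induct)
  case (large s)
  have "\<psi> [] \<in> \<F>" using large(1,2) by (simp add: words_ge_1)
  thus ?case using large(1) by (intro bexI[of _ "\<psi> []"]) (simp_all add: words_ge_1)
next
  case (small s)
  have mem: "i # w \<in> words s" if "w \<in> words (s / ratio i)" for i w
    using that small.hyps by (auto simp: words_less_1)
  have "\<exists>u\<in>\<F>. \<forall>w\<in>words (s / ratio i). u \<circ> word_map F w = \<psi> (i # w)" for i
  proof (rule small.IH)
    show "\<psi> (i # w) \<in> \<F>" if "w \<in> words (s / ratio i)" for w using small.prems(1) mem that by blast
    show "\<psi> (i # v) a = \<psi> (i # w) b"
      if "v \<in> words (s / ratio i)" "w \<in> words (s / ratio i)" "word_map F v a = word_map F w b" for v w a b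
      using that mem by (intro small.prems(2)) auto
  qed
  then obtain u where u: "\<And>i. u i \<in> \<F>" "\<And>i w. w \<in> words (s / ratio i) \<Longrightarrow> u i \<circ> word_map F w = \<psi> (i # w)"
    by metis
  have "u i a = u j b" if eq: "F i a = F j b" for i j a b
  proof -
    obtain v a' where v: "v \<in> words (s / ratio i)" "a = word_map F v a'"
      using cell_cover[of "s / ratio i" a] small.hyps ratio_pos by (auto simp: cell_def)
    obtain w b' where w: "w \<in> words (s / ratio j)" "b = word_map F w b'"
      using cell_cover[of "s / ratio j" b] small.hyps ratio_pos by (auto simp: cell_def)
    have "\<psi> (i # v) a' = \<psi> (j # w) b'" using eq by (intro small.prems(2) mem v(1) w(1)) (simp add: v w)
    thus ?thesis using fun_cong[OF u(2)[OF v(1)], of a'] fun_cong[OF u(2)[OF w(1)], of b'] by (simp add: v w)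
  qed
  then obtain v where v: "v \<in> \<F>" "\<And>i. v \<circ> F i = u i" using glue_level_one[of u] u(1) by metis
  have "v \<circ> word_map F w = \<psi> w" if "w \<in> words s" for w
  proof -
    obtain i w' where w: "w = i # w'" "w' \<in> words (s / ratio i)"
      using \<open>w \<in> words s\<close> small.hyps by (auto simp: words_less_1)
    have "v \<circ> word_map F w = (v \<circ> F i) \<circ> word_map F w'" by (simp only: w word_map.simps o_assoc)
    thus ?thesis using u(2)[OF w(2)] by (simp only: v w)
  qed
  thus ?case using v(1) by blast
qed

text \<open>
  A function that separates \<open>x\<close> from \<open>y\<close> at low energy certifies that
  they are far apart.
\<close>

lemma resistance_metric_ge:
  assumes u: "u \<in> \<F>" "u x = 1" "u y = 0" and Q: "\<E> u \<le> Q"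
  shows "(1 / Q) powr (1 / (p - 1)) \<le> p_resistance_metric p \<E> \<F> x y"
proof -
  have nonconst: "u \<notin> range (\<lambda>c _. c)" using u by auto
  hence pos: "\<E> u > 0" using energy_eq_0_iff[OF u(1)] energy_nonneg[OF u(1)] by (force simp: less_le)
  have "ennreal (1 / Q) \<le> ennreal (\<bar>u x - u y\<bar> powr p / \<E> u)"
    using pos Q u by (intro ennreal_leI) (simp add: frac_le)
  also have "\<dots> \<le> p_resistance p \<E> \<F> x y"
    unfolding p_resistance_def using u nonconst by (intro SUP_upper) auto
  finally have "enn2real (ennreal (1 / Q)) \<le> enn2real (p_resistance p \<E> \<F> x y)"
    using p_resistance_finite by (intro enn2real_mono) auto
  hence "1 / Q \<le> enn2real (p_resistance p \<E> \<F> x y)" using pos Q by simp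
  thus ?thesis unfolding p_resistance_metric_def using pos Q p_gt_1 by (intro powr_mono2) auto
qed

definition neighbours :: "real \<Rightarrow> 's list \<Rightarrow> 's list set" where
  "neighbours s w = {v \<in> words s. cell v \<inter> cell w \<noteq> {}}"

lemma self_neighbour: "w \<in> words s \<Longrightarrow> w \<in> neighbours s w"
  by (auto simp: neighbours_def cell_def)

text \<open>
  Words in \<open>words s\<close> are pairwise incomparable: no infinite sequence begins with two
  of them.
\<close>

lemma word_append_eq_imp_eq:
  assumes "0 < s" "v \<in> words s" "w \<in> words s" "word_append v \<alpha> = word_append w \<beta>"
  shows "v = w"
  using assms
proof (induction s arbitrary: v w rule: scale_induct)
  case (small s)
  thus ?case by (auto simp: words_less_1)
qed (simp add: words_ge_1)

end

section \<open>Post-critical finiteness and the resistance between separated cells\<close>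

locale pcf_form = self_similar_form p \<E> \<F> F \<rho> chi
  for p :: real and \<E> :: "('a::metric_space \<Rightarrow> real) \<Rightarrow> real" and \<F> :: "('a \<Rightarrow> real) set"
    and F :: "'s::finite \<Rightarrow> 'a \<Rightarrow> 'a" and \<rho> :: "'s \<Rightarrow> real" and chi :: "(nat \<Rightarrow> 's) \<Rightarrow> 'a" +
  assumes pcf: "finite (\<Union>n\<in>{1..}. (shift ^^ n) ` critical_set F chi)"
begin

text \<open>
  The set usually called \<open>V\<^sub>0\<close>; different cells of one partition meet only in
  images of its points.
\<close>

definition boundary :: "'a set" where
  "boundary = chi ` (\<Union>n\<in>{1..}. (shift ^^ n) ` critical_set F chi)"

lemma finite_boundary: "finite boundary"
  using pcf by (simp add: boundary_def)

lemma finite_critical_set: "finite (critical_set F chi)"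
proof -
  have *: "shift \<omega> \<in> (\<Union>n\<in>{1..}. (shift ^^ n) ` critical_set F chi)" if "\<omega> \<in> critical_set F chi" for \<omega>
    using that by (intro UN_I[of 1]) auto
  hence "critical_set F chi \<subseteq> (\<lambda>(i, \<omega>). prepend i \<omega>) ` (UNIV \<times> (\<Union>n\<in>{1..}. (shift ^^ n) ` critical_set F chi))"
  proof (intro subsetI)
    fix \<omega> assume "\<omega> \<in> critical_set F chi"
    from this[THEN *] show "\<omega> \<in> (\<lambda>(i, \<omega>). prepend i \<omega>) ` (UNIV \<times> (\<Union>n\<in>{1..}. (shift ^^ n) ` critical_set F chi))"
      by (intro rev_image_eqI[of "(\<omega> 0, shift \<omega>)"]) (simp_all add: prepend_shift)
  qed
  thus ?thesis by (rule finite_subset) (intro finite_imageI finite_cartesian_product pcf finite_class.finite_UNIV)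
qed

text \<open>
  Remove the common prefix of \<open>v\<close> and \<open>w\<close>. The two cells then begin with
  different letters, so every code of the common point that begins with the rest of
  \<open>v\<close> is in the critical set, and shifting it by the length of that rest gives a code
  of \<open>a\<close>.
\<close>

lemma cells_meet_in_boundary:
  assumes "0 < s" "v \<in> words s" "w \<in> words s" "v \<noteq> w" "word_map F v a = word_map F w b"
  shows "a \<in> boundary"
  using assms
proof (induction s arbitrary: v w rule: scale_induct)
  case (small s)
  obtain i v' where v: "v = i # v'" "v' \<in> words (s / ratio i)"
    using small.prems(1) unfolding words_less_1[OF small.hyps] by blast
  obtain j w' where w: "w = j # w'" "w' \<in> words (s / ratio j)"
    using small.prems(2) unfolding words_less_1[OF small.hyps] by blast
  note vw = v w
  show ?case
  proof (cases "i = j")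
    case True
    have "F i (word_map F v' a) = F i (word_map F w' b)"
      using small.prems(4) True by (simp add: vw)
    hence eq: "word_map F v' a = word_map F w' b" by (rule injD[OF inj_F])
    have "v' \<noteq> w'" using small.prems(3) vw True by simp
    from small.IH[OF v(2) _ this eq] show ?thesis using w(2) True by simp
  next
    case False
    obtain \<alpha> where \<alpha>: "a = chi \<alpha>" using surj_chi by blast
    have "word_map F v a \<in> range (F i) \<inter> range (F j)"
    proof
      show "word_map F v a \<in> range (F i)" by (simp add: vw)
      show "word_map F v a \<in> range (F j)" by (simp add: small.prems(4) vw(3))
    qed
    hence "chi (word_append v \<alpha>) \<in> range (F i) \<inter> range (F j)" by (simp only: \<alpha> word_map_chi)
    hence "word_append v \<alpha> \<in> critical_set F chi"
      unfolding critical_set_def vimage_eq using False by (intro UN_I[of i] UN_I[of j]) auto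
    moreover have "(shift ^^ length v) (word_append v \<alpha>) = \<alpha>" by (rule funpow_shift_word_append)
    ultimately have "\<alpha> \<in> (\<Union>n\<in>{1..}. (shift ^^ n) ` critical_set F chi)"
      by (intro UN_I[of "length v"] rev_image_eqI[of "word_append v \<alpha>"]) (simp_all add: vw)
    thus ?thesis by (simp add: \<alpha> boundary_def)
  qed
qed (simp add: words_ge_1)

text \<open>
  Zoom into the smallest cell in which all codes of \<open>x\<close> agree: there,
  \<open>x\<close> becomes a point of some \<open>F i ` UNIV \<inter> F j ` UNIV\<close> with
  \<open>i \<noteq> j\<close>, all codes of which are in the critical set. Different words of the
  partition need different codes. The summand \<open>1\<close> is for a point with a single code.
\<close>

lemma card_cells_through_point:
  "0 < s \<Longrightarrow> card {v \<in> words s. x \<in> cell v} \<le> card (critical_set F chi) + 1"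
proof (induction s arbitrary: x rule: scale_induct)
  case (large s)
  have "card {v \<in> words s. x \<in> cell v} \<le> card {[] :: 's list}"
    using large by (intro card_mono) (auto simp: words_ge_1)
  thus ?case by simp
next
  case (small s)
  define A where "A = {v \<in> words s. x \<in> cell v}"
  obtain i y where x: "x = F i y" using range_F_cover by blast
  show ?case
  proof (cases "\<exists>j. j \<noteq> i \<and> x \<in> range (F j)")
    case False
    have "A \<subseteq> (#) i ` {v \<in> words (s / ratio i). y \<in> cell v}"
    proof
      fix v assume "v \<in> A"
      then obtain k v' a where v: "v = k # v'" "v' \<in> words (s / ratio k)" "x = F k (word_map F v' a)"
        using small.hyps by (auto simp: A_def words_less_1 cell_def)
      hence "k = i" using False by blast
      with v x have "F i y = F i (word_map F v' a)" by simp
      hence "y = word_map F v' a" by (rule injD[OF inj_F])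
      thus "v \<in> (#) i ` {v \<in> words (s / ratio i). y \<in> cell v}" using v \<open>k = i\<close> by (auto simp: cell_def)
    qed
    moreover have fin: "finite {v \<in> words (s / ratio i). y \<in> cell v}"
      using small.hyps ratio_pos finite_words by simp
    ultimately have "card A \<le> card {v \<in> words (s / ratio i). y \<in> cell v}"
      by (rule surj_card_le[rotated])
    also have "\<dots> \<le> card (critical_set F chi) + 1" by (rule small.IH)
    finally show ?thesis by (simp add: A_def)
  next
    case True
    then obtain j where "j \<noteq> i" "x \<in> range (F j)" by blast
    hence crit: "\<omega> \<in> critical_set F chi" if "chi \<omega> = x" for \<omega>
      unfolding critical_set_def vimage_eq that
      by (intro UN_I[of i] UN_I[of j] IntI) (simp_all add: x)
    have "\<forall>v\<in>A. \<exists>\<alpha>. chi (word_append v \<alpha>) = x"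
    proof
      fix v assume "v \<in> A"
      then obtain a where a: "x = word_map F v a" by (auto simp: A_def cell_def)
      obtain \<alpha> where "a = chi \<alpha>" using surj_chi by blast
      thus "\<exists>\<alpha>. chi (word_append v \<alpha>) = x" by (auto simp: a word_map_chi)
    qed
    then obtain \<alpha> where \<alpha>: "\<And>v. v \<in> A \<Longrightarrow> chi (word_append v (\<alpha> v)) = x" by metis
    have "inj_on (\<lambda>v. word_append v (\<alpha> v)) A"
      using word_append_eq_imp_eq[OF small.hyps(1)] by (intro inj_onI) (auto simp: A_def)
    hence "card A \<le> card (critical_set F chi)"
      using crit \<alpha> finite_critical_set by (intro card_inj_on_le) auto
    thus ?thesis by (simp add: A_def)
  qed
qed

definition neighbour_bound :: nat where
  "neighbour_bound = 1 + card boundary * (card (critical_set F chi) + 1)"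

lemma neighbour_bound_pos: "0 < neighbour_bound"
  by (simp add: neighbour_bound_def)

text \<open>
  A neighbour other than \<open>w\<close> itself contains the image of a boundary point under the
  map of \<open>w\<close>.
\<close>

lemma card_neighbours:
  assumes "0 < s" "w \<in> words s"
  shows "card (neighbours s w) \<le> neighbour_bound"
proof -
  have "neighbours s w \<subseteq> insert w (\<Union>b\<in>boundary. {v \<in> words s. word_map F w b \<in> cell v})"
  proof
    fix v assume "v \<in> neighbours s w"
    then obtain a b where v: "v \<in> words s" "word_map F w b = word_map F v a"
      by (auto simp: neighbours_def cell_def image_iff) metis
    show "v \<in> insert w (\<Union>b\<in>boundary. {v \<in> words s. word_map F w b \<in> cell v})"
      using cells_meet_in_boundary[OF assms v(1) _ v(2)] v by (auto simp: cell_def)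
  qed
  hence "card (neighbours s w) \<le> card (insert w (\<Union>b\<in>boundary. {v \<in> words s. word_map F w b \<in> cell v}))"
    using finite_boundary finite_words[OF assms(1)] by (intro card_mono) auto
  also have "\<dots> \<le> Suc (card (\<Union>b\<in>boundary. {v \<in> words s. word_map F w b \<in> cell v}))"
    by (rule card_insert_le_m1) auto
  also have "\<dots> \<le> Suc (\<Sum>b\<in>boundary. card {v \<in> words s. word_map F w b \<in> cell v})"
    using card_UN_le[OF finite_boundary] by simp
  also have "\<dots> \<le> Suc (\<Sum>b\<in>boundary. card (critical_set F chi) + 1)"
    using card_cells_through_point[OF assms(1)] by (intro Suc_le_mono[THEN iffD2] sum_mono)
  finally show ?thesis by (simp add: neighbour_bound_def)
qed

text \<open>
  The building blocks of cutoff functions on the cells of a partition: one function for each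
  possible pattern of values \<open>0\<close>, \<open>1\<close> on the finite boundary. Only
  finitely many patterns occur, so their energies have a common bound.
\<close>

lemma boundary_separation:
  obtains h H where "\<And>B. h B \<in> \<F>" "\<And>B. \<E> (h B) \<le> H" "0 < H" "h {} = (\<lambda>_. 0)"
    "\<And>B x. B \<subseteq> boundary \<Longrightarrow> x \<in> boundary \<Longrightarrow> h B x = (if x \<in> B then 1 else 0)"
proof -
  have "\<exists>h\<in>\<F>. \<forall>x\<in>boundary. h x = (if x \<in> B then 1 else 0)" for B
  proof -
    have cl: "closed (boundary \<inter> B)" "closed (boundary - B)" using finite_boundary by (auto intro: finite_imp_closed)
    have disj: "(boundary \<inter> B) \<inter> (boundary - B) = {}" by blast
    obtain \<phi> where "\<phi> \<in> \<F>" "\<And>x. 0 \<le> \<phi> x" "\<And>x. \<phi> x \<le> 1"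
      "\<And>x. x \<in> boundary \<inter> B \<Longrightarrow> \<phi> x = 1" "\<And>x. x \<in> boundary - B \<Longrightarrow> \<phi> x = 0"
      by (rule cutoff[OF cl disj]) blast
    thus ?thesis by (intro bexI[of _ \<phi>]) auto
  qed
  then obtain g where g: "\<And>B. g B \<in> \<F>" "\<And>B x. x \<in> boundary \<Longrightarrow> g B x = (if x \<in> B then 1 else 0)" by metis
  define h where "h B = (if B = {} \<or> \<not> B \<subseteq> boundary then (\<lambda>_. 0) else g B)" for B
  have h: "h B \<in> \<F>" for B using g const_mem by (simp add: h_def)
  define H where "H = 1 + (\<Sum>B\<in>Pow boundary. \<E> (h B))"
  have H: "0 \<le> (\<Sum>B\<in>Pow boundary. \<E> (h B))" by (intro sum_nonneg energy_nonneg h)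
  have "\<E> (h B) \<le> H" for B
  proof (cases "B \<in> Pow boundary")
    case True
    hence "\<E> (h B) \<le> (\<Sum>B\<in>Pow boundary. \<E> (h B))"
      using finite_boundary energy_nonneg[OF h] by (intro member_le_sum) auto
    thus ?thesis by (simp add: H_def)
  next
    case False thus ?thesis using H by (simp add: h_def H_def energy_const)
  qed
  thus ?thesis using h H g(2) by (intro that[of h H]) (auto simp: H_def h_def)
qed

text \<open>
  Points in cells of scale \<open>s\<close> that do not touch are at resistance distance at least
  a multiple of \<open>s\<close>. The function certifying this is \<open>1\<close> on \<open>cell
  w\<close>, vanishes on all cells that do not touch it, and on each neighbour is a scaled copy of
  one of finitely many functions. Its energy is a sum over at most \<open>neighbour_bound\<close>
  neighbours, each contributing at most a constant times its weight, that is, times a power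
  \<open>- (p - 1)\<close> of \<open>s\<close>.
\<close>

lemma resistance_between_separated_cells:
  obtains \<alpha> where "0 < \<alpha>"
    "\<And>s w x y. 0 < s \<Longrightarrow> w \<in> words s \<Longrightarrow> x \<in> cell w \<Longrightarrow> (\<And>v. v \<in> neighbours s w \<Longrightarrow> y \<notin> cell v) \<Longrightarrow>
       \<alpha> * s \<le> p_resistance_metric p \<E> \<F> x y"
proof -
  obtain h H where h: "\<And>B. h B \<in> \<F>" "\<And>B. \<E> (h B) \<le> H" "0 < H" "h {} = (\<lambda>_. 0)"
    "\<And>B x. B \<subseteq> boundary \<Longrightarrow> x \<in> boundary \<Longrightarrow> h B x = (if x \<in> B then 1 else 0)"
    using boundary_separation by blast
  define \<alpha> where "\<alpha> = (1 / (real neighbour_bound * H)) powr (1 / (p - 1)) * min_ratio"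
  have NH: "0 < real neighbour_bound * H" using h(3) neighbour_bound_pos by simp
  show ?thesis
  proof (rule that[of \<alpha>])
    show "0 < \<alpha>" unfolding \<alpha>_def using neighbour_bound_pos h(3) min_ratio(1) by (intro mult_pos_pos) auto
    fix s w x y
    assume s: "0 < s" and w: "w \<in> words s" and x: "x \<in> cell w"
      and y: "\<And>v. v \<in> neighbours s w \<Longrightarrow> y \<notin> cell v"
    have s1: "s < 1"
    proof (rule ccontr)
      assume "\<not> s < 1"
      hence "w = []" using w by (simp add: words_ge_1)
      thus False using y[OF self_neighbour[OF w]] by (simp add: cell_def)
    qed
    \<comment> \<open>The function \<open>\<psi> v\<close> describes the cutoff on the cell of \<open>v\<close> in its own coordinates. The word \<open>w\<close> is treated
      separately because the values on the boundary alone do not force \<open>1\<close> throughout its cell.\<close>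
    define trace where "trace v = {b \<in> boundary. word_map F v b \<in> cell w}" for v
    define \<psi> where "\<psi> v = (if v = w then (\<lambda>_. 1) else h (trace v))" for v
    have \<psi>: "\<psi> v \<in> \<F>" for v using h const_mem by (simp add: \<psi>_def)
    have \<psi>_boundary: "\<psi> v a = (if word_map F v a \<in> cell w then 1 else 0)" if "a \<in> boundary" for v a
      using that h(5)[of "trace v" a] by (auto simp: \<psi>_def trace_def cell_def)
    have "\<psi> v a = \<psi> v' b" if "v \<in> words s" "v' \<in> words s" "word_map F v a = word_map F v' b" for v v' a b
    proof (cases "v = v'")
      case True thus ?thesis using that injD[OF inj_word_map] by metis
    next
      case False
      hence "a \<in> boundary" "b \<in> boundary"
        using cells_meet_in_boundary[OF s that(1,2) _ that(3)]
          cells_meet_in_boundary[OF s that(2,1) _ that(3)[symmetric]] by auto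
      thus ?thesis by (simp add: \<psi>_boundary that(3))
    qed
    then obtain u where u: "u \<in> \<F>" "\<And>v. v \<in> words s \<Longrightarrow> u \<circ> word_map F v = \<psi> v"
      using glue[OF s, of \<psi>] \<psi> by blast
    have far: "\<psi> v = (\<lambda>_. 0)" if "v \<in> words s - neighbours s w" for v
    proof -
      have "trace v = {}" using that by (auto simp: trace_def neighbours_def cell_def)
      thus ?thesis using that self_neighbour[OF w] h(4) by (auto simp: \<psi>_def)
    qed
    define q where "q = (min_ratio * s) powr (- (p - 1))"
    have "\<E> u = (\<Sum>v\<in>words s. weight v * \<E> (\<psi> v))"
      unfolding energy_sum_words[OF s u(1)] by (intro sum.cong refl) (simp add: u(2))
    also have "\<dots> = (\<Sum>v\<in>neighbours s w. weight v * \<E> (\<psi> v))"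
      using far finite_words[OF s]
      by (intro sum.mono_neutral_right) (auto simp: neighbours_def energy_const)
    also have "\<dots> \<le> (\<Sum>v\<in>neighbours s w. q * H)"
    proof (intro sum_mono mult_mono)
      fix v assume "v \<in> neighbours s w"
      thus "weight v \<le> q" unfolding q_def using s s1
        by (intro weight_words_le) (auto simp: neighbours_def)
      show "\<E> (\<psi> v) \<le> H" using h by (simp add: \<psi>_def energy_const)
    qed (auto simp: q_def energy_nonneg \<psi>)
    also have "\<dots> \<le> real neighbour_bound * (q * H)"
      using card_neighbours[OF s w] h(3) by (simp add: q_def mult_right_mono)
    finally have energy: "\<E> u \<le> real neighbour_bound * H * q" by (simp add: mult_ac)
    obtain a where "x = word_map F w a" using x by (auto simp: cell_def)
    hence "u x = 1" using fun_cong[OF u(2)[OF w], of a] by (simp add: \<psi>_def)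
    moreover have "u y = 0"
    proof -
      obtain v c where v: "v \<in> words s" "y \<in> cell v" "y = word_map F v c"
        using cell_cover[OF s, of y] by (auto simp: cell_def)
      hence "v \<notin> neighbours s w" using y by blast
      thus ?thesis using fun_cong[OF u(2)[OF v(1)], of c] far[of v] v by simp
    qed
    ultimately have "(1 / (real neighbour_bound * H * q)) powr (1 / (p - 1)) \<le> p_resistance_metric p \<E> \<F> x y"
      using energy by (intro resistance_metric_ge[OF u(1)])
    also have "(1 / (real neighbour_bound * H * q)) powr (1 / (p - 1)) = \<alpha> * s"
    proof -
      have "1 / q = (min_ratio * s) powr (p - 1)" unfolding q_def powr_minus by (simp add: divide_inverse)
      hence "(1 / q) powr (1 / (p - 1)) = min_ratio * s"
        using p_gt_1 min_ratio s by (simp add: powr_powr)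
      moreover have "1 / (real neighbour_bound * H * q) = 1 / (real neighbour_bound * H) * (1 / q)" by simp
      ultimately show ?thesis using NH by (simp only: powr_mult \<alpha>_def mult.assoc)
    qed
    finally show "\<alpha> * s \<le> p_resistance_metric p \<E> \<F> x y" .
  qed
qed

end

section \<open>The self-similar measure\<close>

locale pcf_form_measure = pcf_form p \<E> \<F> F \<rho> chi
  for p :: real and \<E> :: "('a::metric_space \<Rightarrow> real) \<Rightarrow> real" and \<F> :: "('a \<Rightarrow> real) set"
    and F :: "'s::finite \<Rightarrow> 'a \<Rightarrow> 'a" and \<rho> :: "'s \<Rightarrow> real" and chi :: "(nat \<Rightarrow> 's) \<Rightarrow> 'a" +
  fixes d :: real and m :: "'a measure"
  assumes d_pos: "0 < d"
    and self_similar_m: "self_similar_measure F (\<lambda>i. \<rho> i powr (- d / (p - 1))) m"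
begin

lemma sets_m [measurable_cong]: "sets m = sets borel"
  and emeasure_m_UNIV: "emeasure m UNIV = 1"
  and emeasure_m_distr: "A \<in> sets borel \<Longrightarrow> 
    emeasure m A = (\<Sum>i\<in>UNIV. ennreal (\<rho> i powr (- d / (p - 1))) * emeasure (distr m borel (F i)) A)"
  using self_similar_m unfolding self_similar_measure_def by auto

lemma space_m [simp]: "space m = UNIV"
  using sets_eq_imp_space_eq[OF sets_m] by simp

lemma emeasure_m_le_1: "emeasure m A \<le> 1"
  using emeasure_space[of m A] by (simp add: emeasure_m_UNIV)

lemma measure_split:
  assumes "A \<in> sets borel"
  shows "emeasure m A = (\<Sum>i\<in>UNIV. ennreal (ratio i powr d) * emeasure m (F i -` A))"
proof -
  have "emeasure (distr m borel (F i)) A = emeasure m (F i -` A)" for i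
  proof -
    have "F i \<in> measurable m borel"
      using borel_measurable_continuous_onI[OF continuous_F] measurable_cong_sets[OF sets_m refl] by blast
    thus ?thesis using assms by (simp add: emeasure_distr)
  qed
  moreover have "\<rho> i powr (- d / (p - 1)) = ratio i powr d" for i by (simp add: ratio_def powr_powr)
  ultimately show ?thesis using emeasure_m_distr[OF assms] by simp
qed

lemma vimage_word_map_borel: "A \<in> sets borel \<Longrightarrow> word_map F w -` A \<in> sets borel"
  using measurable_sets_borel[OF borel_measurable_continuous_onI[OF continuous_word_map]] by simp

lemma vimage_F_borel: "A \<in> sets borel \<Longrightarrow> F i -` A \<in> sets borel"
  using vimage_word_map_borel[of A "[i]"] by simp

lemma measure_words:
  "0 < s \<Longrightarrow> A \<in> sets borel \<Longrightarrow>
    emeasure m A = (\<Sum>w\<in>words s. ennreal (scale w powr d) * emeasure m (word_map F w -` A))"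
proof (induction s arbitrary: A rule: scale_induct)
  case (small s)
  have "emeasure m A = (\<Sum>i\<in>UNIV. ennreal (ratio i powr d) *
      (\<Sum>w\<in>words (s / ratio i). ennreal (scale w powr d) * emeasure m (word_map F w -` (F i -` A))))"
    unfolding measure_split[OF small.prems] using small.prems
    by (intro sum.cong refl arg_cong2[where f="(*)"] small.IH vimage_F_borel)
  also have "\<dots> = (\<Sum>i\<in>UNIV. \<Sum>w\<in>words (s / ratio i).
      ennreal (scale (i # w) powr d) * emeasure m (word_map F (i # w) -` A))"
    by (simp add: sum_distrib_left powr_mult ennreal_mult mult.assoc vimage_comp)
  finally show ?case using small.hyps by (simp add: sum_words)
qed (simp add: words_ge_1)

lemma cell_borel: "cell w \<in> sets borel"
  using compact_cell by (simp add: borel_compact)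

text \<open>
  Self-similarity writes the mass of \<open>cell w\<close> as a sum over the partition of
  \<open>scale v powr d\<close> times the mass of a preimage. The preimage is empty unless
  \<open>v\<close> is a neighbour, so at most \<open>neighbour_bound\<close> terms count, each at
  most \<open>s powr d\<close>.
\<close>

lemma emeasure_cell_le:
  assumes s: "0 < s" and w: "w \<in> words s"
  shows "emeasure m (cell w) \<le> ennreal (real neighbour_bound * s powr d)"
proof -
  have "emeasure m (cell w) = (\<Sum>v\<in>words s. ennreal (scale v powr d) * emeasure m (word_map F v -` cell w))"
    by (intro measure_words s cell_borel)
  also have "\<dots> = (\<Sum>v\<in>neighbours s w. ennreal (scale v powr d) * emeasure m (word_map F v -` cell w))"
  proof (intro sum.mono_neutral_right finite_words s ballI)
    fix v assume "v \<in> words s - neighbours s w"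
    hence "word_map F v -` cell w = {}" by (auto simp: neighbours_def cell_def)
    thus "ennreal (scale v powr d) * emeasure m (word_map F v -` cell w) = 0" by simp
  qed (auto simp: neighbours_def)
  also have "\<dots> \<le> (\<Sum>v\<in>neighbours s w. ennreal (s powr d) * 1)"
    using d_pos scale_pos scale_words_le
    by (intro sum_mono mult_mono emeasure_m_le_1 ennreal_leI powr_mono2)
       (auto simp: neighbours_def less_imp_le)
  also have "\<dots> \<le> ennreal (real neighbour_bound * s powr d)"
    using card_neighbours[OF s w]
    by (simp add: ennreal_of_nat_eq_real_of_nat ennreal_mult[symmetric] ennreal_leI mult_right_mono)
  finally show ?thesis .
qed

lemma emeasure_cell_pos:
  assumes s: "0 < s" and w: "w \<in> words s"
  shows "0 < emeasure m (cell w)"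
proof -
  have "word_map F w -` cell w = UNIV" by (auto simp: cell_def)
  hence "ennreal (scale w powr d) = ennreal (scale w powr d) * emeasure m (word_map F w -` cell w)"
    by (simp add: emeasure_m_UNIV)
  also have "\<dots> \<le> emeasure m (cell w)"
    unfolding measure_words[OF s cell_borel[of w]] by (intro member_le_sum w finite_words s) auto
  finally show ?thesis using scale_pos[of w] by (auto simp: zero_less_iff_neq_zero)
qed

lemma emeasure_open_pos:
  assumes "open U" "U \<noteq> {}" shows "0 < emeasure m U"
proof -
  obtain x e where x: "0 < e" "ball x e \<subseteq> U" using assms by (meson equals0I open_contains_ball)
  obtain s where s: "0 < s" "\<And>w x y. w \<in> words s \<Longrightarrow> x \<in> cell w \<Longrightarrow> y \<in> cell w \<Longrightarrow> dist x y < e"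
    using small_cells[OF x(1)] by (metis order_refl)
  obtain w where w: "w \<in> words s" "x \<in> cell w" using cell_cover[OF s(1)] by blast
  have "cell w \<subseteq> U" using s(2)[OF w] x(2) by auto
  hence "emeasure m (cell w) \<le> emeasure m U" using assms(1) by (intro emeasure_mono) (auto simp: sets_m)
  thus ?thesis using emeasure_cell_pos[OF s(1) w(1)] by simp
qed

text \<open>
  Every non-empty open set contains a cell, so \<open>m\<close> has full support.
\<close>

lemma mem_eq_if_AE_eq:
  assumes u: "u \<in> \<F>" "v \<in> \<F>" and ae: "AE x in m. u x = v x"
  shows "u = v"
proof (rule ccontr)
  assume "u \<noteq> v"
  have op: "open {x. u x \<noteq> v x}" using mem_continuous[OF u(1)] mem_continuous[OF u(2)] by (intro open_Collect_neq)
  hence "{x. u x \<noteq> v x} \<in> sets m" by (simp add: sets_m)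
  hence "{x. u x \<noteq> v x} \<in> null_sets m" using ae by (simp add: AE_iff_null_sets)
  hence "emeasure m {x. u x \<noteq> v x} = 0" by auto
  moreover have "{x. u x \<noteq> v x} \<noteq> {}" using \<open>u \<noteq> v\<close> by auto
  ultimately show False using emeasure_open_pos[OF op] by simp
qed

lemma extended_energy_eq:
  assumes "v \<in> \<F>" "AE x in m. f x = v x"
  shows "extended_energy \<E> \<F> m f = ennreal (\<E> v)"
proof -
  have uniq: "v' = v" if v': "v' \<in> \<F> \<and> (AE x in m. f x = v' x)" for v'
  proof (rule mem_eq_if_AE_eq)
    have "AE x in m. f x = v' x" using v' by blast
    with assms(2) show "AE x in m. v' x = v x" by eventually_elim simp
  qed (use v' assms in blast)+
  have "(THE v. v \<in> \<F> \<and> (AE x in m. f x = v x)) = v"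
    by (rule the_equality) (use assms in blast, rule uniq)
  moreover have "\<exists>v\<in>\<F>. AE x in m. f x = v x" using assms by blast
  ultimately show ?thesis unfolding extended_energy_def by simp
qed

section \<open>Korevaar--Schoen functionals against cell energies\<close>

text \<open>
  The resistance is a supremum of functions continuous in \<open>y\<close>, hence lower
  semicontinuous.
\<close>

lemma resistance_ball_borel: "resistance_ball p \<E> \<F> x s \<in> sets borel"
proof -
  have "(\<lambda>y. p_resistance p \<E> \<F> x y) \<in> borel_measurable borel"
  proof (rule borel_measurableI_le)
    fix c :: ennreal
    have "closed {y. ennreal (\<bar>u x - u y\<bar> powr p / \<E> u) \<le> c}" if "u \<in> \<F> - range (\<lambda>c _. c)" for u
    proof (intro closed_Collect_le continuous_on_ennreal continuous_on_const)
      have "continuous_on UNIV u" using mem_continuous that by blast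
      moreover have "\<E> u \<noteq> 0" using that energy_eq_0_iff[of u] by auto
      ultimately show "continuous_on UNIV (\<lambda>y. \<bar>u x - u y\<bar> powr p / \<E> u)"
        using p_gt_1 by (intro continuous_intros continuous_on_powr') auto
    qed
    hence "closed (\<Inter>u\<in>\<F> - range (\<lambda>c _. c). {y. ennreal (\<bar>u x - u y\<bar> powr p / \<E> u) \<le> c})"
      by (intro closed_INT) auto
    also have "(\<Inter>u\<in>\<F> - range (\<lambda>c _. c). {y. ennreal (\<bar>u x - u y\<bar> powr p / \<E> u) \<le> c}) =
      {y \<in> space borel. p_resistance p \<E> \<F> x y \<le> c}" by (auto simp: p_resistance_def SUP_le_iff)
    finally show "{y \<in> space borel. p_resistance p \<E> \<F> x y \<le> c} \<in> sets borel" by (rule borel_closed)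
  qed
  hence [measurable]: "(\<lambda>y. p_resistance_metric p \<E> \<F> x y) \<in> borel_measurable borel"
    unfolding p_resistance_metric_def by measurable
  have "{y \<in> space borel. p_resistance_metric p \<E> \<F> x y < s} \<in> sets borel" by measurable
  thus ?thesis by (simp add: resistance_ball_def)
qed

text \<open>
  For a null set \<open>B\<close> the left-hand side is \<open>\<infinity> * 0 = 0\<close>.
\<close>

lemma average_le:
  assumes B: "B \<in> sets m" and le: "\<And>y. y \<in> B \<Longrightarrow> g y \<le> c"
  shows "1 / emeasure m B * (\<integral>\<^sup>+y\<in>B. g y \<partial>m) \<le> c"
proof -
  have "(\<integral>\<^sup>+y\<in>B. g y \<partial>m) \<le> (\<integral>\<^sup>+y. c * indicator B y \<partial>m)"
    using le by (intro nn_integral_mono) (auto split: split_indicator)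
  also have "\<dots> = c * emeasure m B" using B by (rule nn_integral_cmult_indicator)
  finally have "1 / emeasure m B * (\<integral>\<^sup>+y\<in>B. g y \<partial>m) \<le> 1 / emeasure m B * (c * emeasure m B)"
    by (rule mult_left_mono) simp
  also have "\<dots> \<le> c"
  proof (cases "emeasure m B = 0")
    case False
    have "emeasure m B < \<infinity>" using le_less_trans[OF emeasure_m_le_1[of B]] by simp
    hence "1 / emeasure m B * emeasure m B = 1"
      using False by (simp add: ennreal_divide_times)
    thus ?thesis by (simp add: mult.left_commute)
  qed simp
  finally show ?thesis .
qed

text \<open>
  Every ball of radius comparable to \<open>t\<close> with centre in \<open>E\<close> is covered
  by these cells.
\<close>

definition near_words :: "real \<Rightarrow> 'a set \<Rightarrow> 's list set" where
  "near_words t E = (\<Union>w\<in>{w \<in> words t. cell w \<inter> E \<noteq> {}}. neighbours t w)"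

text \<open>
  The partition is taken at the coarser scale \<open>s / \<alpha>\<close> to make cells that do
  not touch at least \<open>s\<close> apart.
\<close>

lemma balls_in_neighbouring_cells:
  obtains \<alpha> where "0 < \<alpha>"
    "\<And>s w x. 0 < s \<Longrightarrow> w \<in> words (s / \<alpha>) \<Longrightarrow> x \<in> cell w \<Longrightarrow>
       resistance_ball p \<E> \<F> x s \<subseteq> (\<Union>v\<in>neighbours (s / \<alpha>) w. cell v)"
proof -
  obtain \<alpha> where \<alpha>: "0 < \<alpha>"
    "\<And>s w x y. 0 < s \<Longrightarrow> w \<in> words s \<Longrightarrow> x \<in> cell w \<Longrightarrow> (\<And>v. v \<in> neighbours s w \<Longrightarrow> y \<notin> cell v) \<Longrightarrow>
       \<alpha> * s \<le> p_resistance_metric p \<E> \<F> x y"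
    using resistance_between_separated_cells by blast
  show ?thesis
  proof (rule that[OF \<alpha>(1)], rule subsetI, rule ccontr)
    fix s w x y
    assume *: "0 < s" "w \<in> words (s / \<alpha>)" "x \<in> cell w" "y \<in> resistance_ball p \<E> \<F> x s"
      "y \<notin> (\<Union>v\<in>neighbours (s / \<alpha>) w. cell v)"
    have "\<alpha> * (s / \<alpha>) \<le> p_resistance_metric p \<E> \<F> x y"
      using * \<alpha>(1) by (intro \<alpha>(2)[of "s / \<alpha>" w x y]) auto
    thus False using *(4) \<alpha>(1) by (simp add: resistance_ball_def)
  qed
qed

text \<open>
  Connect \<open>x\<close> to \<open>y\<close> through a point common to the two cells, and use
  the oscillation bound in each of them.
\<close>

lemma neighbouring_cells_oscillation:
  obtains D where "0 < D"
    "\<And>u t w v x y. u \<in> \<F> \<Longrightarrow> 0 < t \<Longrightarrow> w \<in> words t \<Longrightarrow> v \<in> neighbours t w \<Longrightarrow> x \<in> cell w \<Longrightarrow> y \<in> cell v \<Longrightarrow>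
       \<bar>u x - u y\<bar> powr p \<le> D * t powr (p - 1) * (\<Sum>v\<in>neighbours t w. weight v * \<E> (u \<circ> word_map F v))"
proof -
  obtain D where D: "0 < D" "\<And>u w x y. u \<in> \<F> \<Longrightarrow> x \<in> cell w \<Longrightarrow> y \<in> cell w \<Longrightarrow>
     \<bar>u x - u y\<bar> powr p \<le> D * \<E> (u \<circ> word_map F w)" using cell_oscillation_bound by blast
  have "\<bar>u x - u y\<bar> powr p \<le> 2 powr p * D * t powr (p - 1) * (\<Sum>v\<in>neighbours t w. weight v * \<E> (u \<circ> word_map F v))"
    if u: "u \<in> \<F>" and t: "0 < t" and w: "w \<in> words t" and v: "v \<in> neighbours t w" and xy: "x \<in> cell w" "y \<in> cell v"
    for u t w v x y
  proof -
    define S where "S = (\<Sum>v\<in>neighbours t w. weight v * \<E> (u \<circ> word_map F v))"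
    have one_cell: "\<bar>u a - u b\<bar> powr p \<le> D * t powr (p - 1) * S"
      if v: "v \<in> neighbours t w" and ab: "a \<in> cell v" "b \<in> cell v" for v a b
    proof -
      have fin: "finite (neighbours t w)" using finite_words[OF t] by (simp add: neighbours_def)
      have "\<E> (u \<circ> word_map F v) = 1 / weight v * (weight v * \<E> (u \<circ> word_map F v))"
        using weight_pos[of v] by simp
      also have "\<dots> \<le> t powr (p - 1) * S"
      proof (rule mult_mono)
        show "1 / weight v \<le> t powr (p - 1)" using v by (intro inverse_weight_words_le) (auto simp: neighbours_def)
        show "weight v * \<E> (u \<circ> word_map F v) \<le> S"
          unfolding S_def using v fin weighted_energy_nonneg[OF u] by (intro member_le_sum) auto
      qed (use weighted_energy_nonneg[OF u] in auto)
      finally have "D * \<E> (u \<circ> word_map F v) \<le> D * (t powr (p - 1) * S)" using D by simp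
      thus ?thesis using order_trans[OF D(2)[OF u ab]] by (simp add: mult.assoc)
    qed
    obtain z where z: "z \<in> cell v" "z \<in> cell w" using v by (auto simp: neighbours_def)
    define M where "M = max \<bar>u x - u z\<bar> \<bar>u z - u y\<bar>"
    have "\<bar>u x - u z\<bar> \<le> M" "\<bar>u z - u y\<bar> \<le> M" by (simp_all add: M_def)
    hence "\<bar>u x - u y\<bar> \<le> 2 * M" by linarith
    hence "\<bar>u x - u y\<bar> powr p \<le> (2 * M) powr p" using p_gt_1 by (intro powr_mono2) auto
    also have "\<dots> = 2 powr p * M powr p" by (simp add: powr_mult M_def)
    also have "M powr p \<le> D * t powr (p - 1) * S"
      using one_cell[OF self_neighbour[OF w] xy(1) z(2)] one_cell[OF v z(1) xy(2)] by (simp add: M_def max_def)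
    finally show ?thesis by (simp add: S_def mult.assoc)
  qed
  thus ?thesis using D(1) by (intro that[of "2 powr p * D"]) auto
qed

text \<open>
  Each cell is a neighbour of at most \<open>neighbour_bound\<close> cells.
\<close>

lemma sum_neighbours_le_near_words:
  assumes u: "u \<in> \<F>" and t: "0 < t"
  shows "(\<Sum>w\<in>{w \<in> words t. cell w \<inter> E \<noteq> {}}. \<Sum>v\<in>neighbours t w. weight v * \<E> (u \<circ> word_map F v))
     \<le> real neighbour_bound * (\<Sum>v\<in>near_words t E. weight v * \<E> (u \<circ> word_map F v))"
proof -
  define W where "W = {w \<in> words t. cell w \<inter> E \<noteq> {}}"
  define e where "e v = weight v * \<E> (u \<circ> word_map F v)" for v
  have fin: "finite W" "finite (near_words t E)"
    using finite_words[OF t] by (auto simp: W_def near_words_def neighbours_def)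
  have "(\<Sum>w\<in>W. \<Sum>v\<in>neighbours t w. e v) = (\<Sum>w\<in>W. \<Sum>v\<in>{v \<in> near_words t E. v \<in> neighbours t w}. e v)"
    by (intro sum.cong refl) (auto simp: W_def near_words_def)
  also have "\<dots> = (\<Sum>v\<in>near_words t E. \<Sum>w\<in>{w \<in> W. v \<in> neighbours t w}. e v)"
    by (rule sum.swap_restrict[OF fin])
  also have "\<dots> \<le> (\<Sum>v\<in>near_words t E. real neighbour_bound * e v)"
  proof (rule sum_mono)
    fix v assume "v \<in> near_words t E"
    hence v: "v \<in> words t" by (auto simp: near_words_def neighbours_def)
    have "card {w \<in> W. v \<in> neighbours t w} \<le> card (neighbours t v)"
      using finite_words[OF t] by (intro card_mono) (auto simp: W_def neighbours_def)
    also have "\<dots> \<le> neighbour_bound" by (rule card_neighbours[OF t v])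
    finally show "(\<Sum>w\<in>{w \<in> W. v \<in> neighbours t w}. e v) \<le> real neighbour_bound * e v"
      using weighted_energy_nonneg[OF u, of v] by (simp add: e_def mult_right_mono)
  qed
  finally show ?thesis by (simp add: W_def e_def sum_distrib_left)
qed

text \<open>
  The central estimate. For \<open>x\<close> in a cell of scale \<open>t = s / \<alpha>\<close>
  the ball of radius \<open>s\<close> lies in the neighbouring cells, so the average over the ball
  is at most a constant times \<open>t powr (p - 1)\<close> times the energy of \<open>u\<close>
  on those cells. Integrating over the cell contributes a factor \<open>t powr d\<close>, and
  together the two powers cancel \<open>s powr (d + p - 1)\<close>.
\<close>

lemma korevaar_schoen_le_cell_energies:
  obtains K \<alpha> where "0 < K" "0 < \<alpha>"
    "\<And>s E x. 0 < s \<Longrightarrow> x \<in> E \<Longrightarrow> resistance_ball p \<E> \<F> x s \<subseteq> (\<Union>v\<in>near_words (s / \<alpha>) E. cell v)"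
    "\<And>u s E. u \<in> \<F> \<Longrightarrow> 0 < s \<Longrightarrow> korevaar_schoen p \<E> \<F> d m E u s
       \<le> ennreal (K * (\<Sum>v\<in>near_words (s / \<alpha>) E. weight v * \<E> (u \<circ> word_map F v)))"
proof -
  obtain \<alpha> where \<alpha>: "0 < \<alpha>" and ball: "\<And>s w x. 0 < s \<Longrightarrow> w \<in> words (s / \<alpha>) \<Longrightarrow> x \<in> cell w \<Longrightarrow>
       resistance_ball p \<E> \<F> x s \<subseteq> (\<Union>v\<in>neighbours (s / \<alpha>) w. cell v)"
    using balls_in_neighbouring_cells by blast
  obtain D where D: "0 < D" and osc: "\<And>u t w v x y. u \<in> \<F> \<Longrightarrow> 0 < t \<Longrightarrow> w \<in> words t \<Longrightarrow> v \<in> neighbours t w \<Longrightarrow>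
       x \<in> cell w \<Longrightarrow> y \<in> cell v \<Longrightarrow>
       \<bar>u x - u y\<bar> powr p \<le> D * t powr (p - 1) * (\<Sum>v\<in>neighbours t w. weight v * \<E> (u \<circ> word_map F v))"
    using neighbouring_cells_oscillation by blast
  define N where "N = real neighbour_bound"
  have N: "0 < N" using neighbour_bound_pos by (simp add: N_def)
  define K0 where "K0 = N * D * \<alpha> powr (- (d + p - 1))"
  have K0: "0 < K0" using N D \<alpha> by (simp add: K0_def)
  have main: "korevaar_schoen p \<E> \<F> d m E u s
       \<le> ennreal (K0 * N * (\<Sum>v\<in>near_words (s / \<alpha>) E. weight v * \<E> (u \<circ> word_map F v)))"
    if u: "u \<in> \<F>" and s: "0 < s" for u s E
  proof -
    define t where "t = s / \<alpha>"
    have t: "0 < t" using s \<alpha> by (simp add: t_def)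
    define S where "S w = (\<Sum>v\<in>neighbours t w. weight v * \<E> (u \<circ> word_map F v))" for w
    have S: "0 \<le> S w" for w unfolding S_def by (intro sum_nonneg weighted_energy_nonneg u)
    define c where "c w = D * t powr (p - 1) * S w / s powr (d + p - 1)" for w
    have c: "0 \<le> c w" for w using D S by (simp add: c_def)
    define W where "W = {w \<in> words t. cell w \<inter> E \<noteq> {}}"
    have fin: "finite W" using finite_words[OF t] by (simp add: W_def)
    have pointwise: "(1 / emeasure m (resistance_ball p \<E> \<F> x s) *
        (\<integral>\<^sup>+y\<in>resistance_ball p \<E> \<F> x s. ennreal (\<bar>u x - u y\<bar> powr p / s powr (d + p - 1)) \<partial>m)) * indicator E x
        \<le> (\<Sum>w\<in>W. ennreal (c w) * indicator (cell w) x)" for x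
    proof (cases "x \<in> E")
      case True
      obtain w where w: "w \<in> words t" "x \<in> cell w" using cell_cover[OF t] by blast
      have "1 / emeasure m (resistance_ball p \<E> \<F> x s) *
        (\<integral>\<^sup>+y\<in>resistance_ball p \<E> \<F> x s. ennreal (\<bar>u x - u y\<bar> powr p / s powr (d + p - 1)) \<partial>m) \<le> ennreal (c w)"
      proof (rule average_le)
        show "resistance_ball p \<E> \<F> x s \<in> sets m" by (simp add: resistance_ball_borel sets_m)
        fix y assume "y \<in> resistance_ball p \<E> \<F> x s"
        then obtain v where "v \<in> neighbours t w" "y \<in> cell v"
          using ball[OF s, of w x] w by (auto simp: t_def)
        from osc[OF u t w(1) this(1) w(2) this(2)]
        show "ennreal (\<bar>u x - u y\<bar> powr p / s powr (d + p - 1)) \<le> ennreal (c w)"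
          unfolding c_def S_def by (intro ennreal_leI divide_right_mono) auto
      qed
      also have "\<dots> = ennreal (c w) * indicator (cell w) x" using w by simp
      also have "\<dots> \<le> (\<Sum>w\<in>W. ennreal (c w) * indicator (cell w) x)"
        using w True by (intro member_le_sum fin) (auto simp: W_def)
      finally show ?thesis using True by simp
    qed simp
    have "korevaar_schoen p \<E> \<F> d m E u s \<le> (\<integral>\<^sup>+x. (\<Sum>w\<in>W. ennreal (c w) * indicator (cell w) x) \<partial>m)"
      unfolding korevaar_schoen_def by (intro nn_integral_mono pointwise)
    also have "\<dots> = (\<Sum>w\<in>W. ennreal (c w) * emeasure m (cell w))"
      using cell_borel by (subst nn_integral_sum) (auto simp: sets_m nn_integral_cmult_indicator)
    also have "\<dots> \<le> (\<Sum>w\<in>W. ennreal (c w) * ennreal (N * t powr d))"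
      unfolding N_def using t by (intro sum_mono mult_left_mono emeasure_cell_le) (auto simp: W_def)
    also have "\<dots> = ennreal (\<Sum>w\<in>W. c w * (N * t powr d))"
      using c N by (simp add: ennreal_mult[symmetric] sum_ennreal)
    also have "(\<Sum>w\<in>W. c w * (N * t powr d)) = (\<Sum>w\<in>W. K0 * S w)"
    proof (intro sum.cong refl)
      fix w
      have "t powr (p - 1) * t powr d / s powr (d + p - 1) = \<alpha> powr (- (d + p - 1))"
      proof -
        have "t powr (p - 1) * t powr d = t powr (d + p - 1)"
          by (simp add: powr_add[symmetric] algebra_simps)
        also have "\<dots> = s powr (d + p - 1) * \<alpha> powr (- (d + p - 1))"
          unfolding t_def powr_minus divide_inverse[symmetric] by (rule powr_divide)
        finally show ?thesis using s by simp
      qed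
      moreover have "c w * (N * t powr d) = N * D * (t powr (p - 1) * t powr d / s powr (d + p - 1)) * S w"
        by (simp add: c_def)
      ultimately show "c w * (N * t powr d) = K0 * S w" by (simp add: K0_def)
    qed
    also have "\<dots> \<le> K0 * (N * (\<Sum>v\<in>near_words t E. weight v * \<E> (u \<circ> word_map F v)))"
      using sum_neighbours_le_near_words[OF u t, of E] K0
      by (simp add: sum_distrib_left[symmetric] W_def S_def N_def)
    finally show ?thesis by (simp add: t_def mult.assoc ennreal_leI)
  qed
  have "resistance_ball p \<E> \<F> x s \<subseteq> (\<Union>v\<in>near_words (s / \<alpha>) E. cell v)" if "0 < s" "x \<in> E" for s E x
  proof -
    have "0 < s / \<alpha>" using that \<alpha> by simp
    then obtain w where w: "w \<in> words (s / \<alpha>)" "x \<in> cell w" using cell_cover by blast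
    hence "neighbours (s / \<alpha>) w \<subseteq> near_words (s / \<alpha>) E" using that by (auto simp: near_words_def)
    thus ?thesis using ball[OF that(1) w] by blast
  qed
  thus ?thesis using main K0 N \<alpha> by (intro that[of "K0 * N" \<alpha>]) auto
qed

end

context self_similar_form begin

section \<open>Energy measures and cell energies\<close>

text \<open>
  Differentiating \<open>\<E> (u + t v) = \<Sum>\<rho>\<^sub>i \<E> ((u + t v) \<circ>
  F\<^sub>i)\<close> term by term is possible since each summand is differentiable.
\<close>

lemma form_deriv_split:
  assumes uv: "u \<in> \<F>" "v \<in> \<F>"
  shows "form_deriv p \<E> u v = (\<Sum>i\<in>UNIV. \<rho> i * form_deriv p \<E> (u \<circ> F i) (v \<circ> F i))"
proof -
  define e where "e i t = \<E> (\<lambda>x. (u \<circ> F i) x + t * (v \<circ> F i) x)" for i t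
  have "(e i has_real_derivative deriv (e i) 0) (at 0)" for i
  proof -
    have "e i differentiable (at 0)"
      unfolding e_def by (intro energy_differentiable comp_F_mem uv)
    then obtain D where "(e i has_real_derivative D) (at 0)" by (auto simp: real_differentiable_def)
    thus ?thesis using DERIV_imp_deriv by blast
  qed
  hence "((\<lambda>t. \<Sum>i\<in>UNIV. \<rho> i * e i t) has_real_derivative (\<Sum>i\<in>UNIV. \<rho> i * deriv (e i) 0)) (at 0)"
    by (intro DERIV_sum DERIV_cmult)
  also have "(\<lambda>t. \<Sum>i\<in>UNIV. \<rho> i * e i t) = (\<lambda>t. \<E> (\<lambda>x. u x + t * v x))"
  proof
    fix t
    have "(\<lambda>x. u x + t * v x) \<in> \<F>" by (intro add_mem scale_mem uv)
    from energy_split[OF this] show "(\<Sum>i\<in>UNIV. \<rho> i * e i t) = \<E> (\<lambda>x. u x + t * v x)"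
      by (simp add: e_def comp_def)
  qed
  finally have "deriv (\<lambda>t. \<E> (\<lambda>x. u x + t * v x)) 0 = (\<Sum>i\<in>UNIV. \<rho> i * deriv (e i) 0)"
    by (rule DERIV_imp_deriv)
  thus ?thesis by (simp add: form_deriv_def e_def[abs_def] sum_distrib_left mult.left_commute)
qed

lemma abs_powr_conjugate_mem:
  assumes "u \<in> \<F>" shows "(\<lambda>x. \<bar>u x\<bar> powr (p / (p - 1))) \<in> \<F>"
proof -
  obtain M where "\<And>x. \<bar>u x\<bar> \<le> M" using mem_bounded[OF assms] by blast
  moreover have "1 \<le> p / (p - 1)" using p_gt_1 by (simp add: field_simps)
  ultimately show ?thesis by (intro abs_powr_mem[OF assms])
qed

lemma form_deriv_self:
  assumes "u \<in> \<F>" shows "form_deriv p \<E> u u = \<E> u"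
proof -
  have "((\<lambda>t. (1 + t) powr p * \<E> u) has_real_derivative p * \<E> u) (at 0)"
    by (auto intro!: derivative_eq_intros)
  moreover have "\<forall>\<^sub>F t in nhds 0. \<E> (\<lambda>x. u x + t * u x) = (1 + t) powr p * \<E> u"
  proof -
    have "\<forall>\<^sub>F t in nhds (0::real). - 1 < t" by (intro eventually_nhds_in_open[of "{-1<..}", simplified]) auto
    thus ?thesis
    proof eventually_elim
      case (elim t)
      thus ?case using energy_scale[OF assms, of "1 + t"] by (simp add: distrib_right)
    qed
  qed
  ultimately have "((\<lambda>t. \<E> (\<lambda>x. u x + t * u x)) has_real_derivative p * \<E> u) (at 0)"
    by (subst DERIV_cong_ev[OF refl _ refl])
  from DERIV_imp_deriv[OF this] show ?thesis using p_gt_1 by (simp add: form_deriv_def)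
qed

lemma form_deriv_const:
  assumes "u \<in> \<F>" shows "form_deriv p \<E> u (\<lambda>_. c) = 0"
  using energy_add_const[OF assms] by (simp add: form_deriv_def)

context
  fixes \<Gamma> :: "('a \<Rightarrow> real) \<Rightarrow> 'a measure"
  assumes \<Gamma>: "\<And>u. u \<in> \<F> \<Longrightarrow> is_p_energy_measure p \<E> \<F> u (\<Gamma> u)"
begin

lemma sets_energy_measure: "u \<in> \<F> \<Longrightarrow> sets (\<Gamma> u) = sets borel"
  and finite_energy_measure: "u \<in> \<F> \<Longrightarrow> finite_measure (\<Gamma> u)"
  and energy_measure_integral: "u \<in> \<F> \<Longrightarrow> \<phi> \<in> \<F> \<Longrightarrow> (\<integral>x. \<phi> x \<partial>\<Gamma> u) =
        form_deriv p \<E> u (\<lambda>x. u x * \<phi> x)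
        - ((p - 1) / p) powr (p - 1) * form_deriv p \<E> (\<lambda>x. \<bar>u x\<bar> powr (p / (p - 1))) \<phi>"
  using \<Gamma>[of u] unfolding is_p_energy_measure_def by blast+

text \<open>
  Test the defining identity with the constant \<open>1\<close>: adding constants does not change
  an energy, so the second term vanishes.
\<close>

lemma energy_measure_total: "u \<in> \<F> \<Longrightarrow> (\<integral>x. 1 \<partial>\<Gamma> u) = \<E> u"
  using energy_measure_integral[OF _ const_mem[of 1], of u]
  by (simp add: form_deriv_self form_deriv_const abs_powr_conjugate_mem)

text \<open>
  Both terms of the identity that defines the energy measure are additive over first level cells,
  so energy measures are self-similar when tested on members of \<open>\<F>\<close>.
\<close>

lemma energy_measure_split:
  assumes u: "u \<in> \<F>" "\<phi> \<in> \<F>"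
  shows "(\<integral>x. \<phi> x \<partial>\<Gamma> u) = (\<Sum>i\<in>UNIV. \<rho> i * (\<integral>x. (\<phi> \<circ> F i) x \<partial>\<Gamma> (u \<circ> F i)))"
proof -
  have "(\<integral>x. \<phi> x \<partial>\<Gamma> u) = (\<Sum>i\<in>UNIV. \<rho> i * form_deriv p \<E> (u \<circ> F i) ((\<lambda>x. u x * \<phi> x) \<circ> F i))
    - ((p - 1) / p) powr (p - 1) *
      (\<Sum>i\<in>UNIV. \<rho> i * form_deriv p \<E> ((\<lambda>x. \<bar>u x\<bar> powr (p / (p - 1))) \<circ> F i) (\<phi> \<circ> F i))"
    unfolding energy_measure_integral[OF u]
    by (simp only: form_deriv_split[OF u(1) bounded_mult_mem[OF u]]
        form_deriv_split[OF abs_powr_conjugate_mem[OF u(1)] u(2)])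
  also have "\<dots> = (\<Sum>i\<in>UNIV. \<rho> i * (form_deriv p \<E> (u \<circ> F i) (\<lambda>x. (u \<circ> F i) x * (\<phi> \<circ> F i) x)
    - ((p - 1) / p) powr (p - 1) * form_deriv p \<E> (\<lambda>x. \<bar>(u \<circ> F i) x\<bar> powr (p / (p - 1))) (\<phi> \<circ> F i)))"
    by (simp add: sum_distrib_left sum_subtractf[symmetric] right_diff_distrib comp_def mult.left_commute)
  also have "\<dots> = (\<Sum>i\<in>UNIV. \<rho> i * (\<integral>x. (\<phi> \<circ> F i) x \<partial>\<Gamma> (u \<circ> F i)))"
    by (simp only: energy_measure_integral comp_F_mem u)
  finally show ?thesis .
qed

lemma energy_measure_words:
  "0 < s \<Longrightarrow> u \<in> \<F> \<Longrightarrow> \<phi> \<in> \<F> \<Longrightarrow> (\<integral>x. \<phi> x \<partial>\<Gamma> u) =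
    (\<Sum>w\<in>words s. weight w * (\<integral>x. (\<phi> \<circ> word_map F w) x \<partial>\<Gamma> (u \<circ> word_map F w)))"
proof (induction s arbitrary: u \<phi> rule: scale_induct)
  case (small s)
  have "(\<integral>x. \<phi> x \<partial>\<Gamma> u) = (\<Sum>i\<in>UNIV. \<rho> i * (\<integral>x. (\<phi> \<circ> F i) x \<partial>\<Gamma> (u \<circ> F i)))"
    by (rule energy_measure_split) fact+
  also have "\<dots> = (\<Sum>i\<in>UNIV. \<rho> i * (\<Sum>w\<in>words (s / ratio i). weight w *
      (\<integral>x. (\<phi> \<circ> F i \<circ> word_map F w) x \<partial>\<Gamma> (u \<circ> F i \<circ> word_map F w))))"
    using small.prems by (intro sum.cong refl arg_cong2[where f="(*)"] small.IH comp_F_mem)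
  finally show ?case using small.hyps by (simp add: sum_words sum_distrib_left comp_def mult.assoc)
qed (simp add: words_ge_1)

text \<open>
  Test the self-similarity of the energy measure with a cutoff function \<open>\<phi>\<close> that
  is \<open>1\<close> on \<open>A\<close> and vanishes outside \<open>U\<close>. Each cell in
  \<open>J\<close> contributes its full energy, the others a nonnegative amount.
\<close>

lemma cell_energies_le_energy_measure:
  assumes s: "0 < s" and u: "u \<in> \<F>" and J: "J \<subseteq> words s" "(\<Union>w\<in>J. cell w) \<subseteq> A"
    and A: "closed A" "A \<subseteq> U" and U: "open U"
  shows "(\<Sum>w\<in>J. weight w * \<E> (u \<circ> word_map F w)) \<le> measure (\<Gamma> u) U"
proof -
  have cl: "closed (- U)" "A \<inter> - U = {}" using A U by auto
  obtain \<phi> where \<phi>: "\<phi> \<in> \<F>" "\<And>x. 0 \<le> \<phi> x" "\<And>x. \<phi> x \<le> 1"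
    "\<And>x. x \<in> A \<Longrightarrow> \<phi> x = 1" "\<And>x. x \<in> - U \<Longrightarrow> \<phi> x = 0"
    by (rule cutoff[OF A(1) cl]) blast
  have "(\<Sum>w\<in>J. weight w * \<E> (u \<circ> word_map F w)) =
      (\<Sum>w\<in>J. weight w * (\<integral>x. (\<phi> \<circ> word_map F w) x \<partial>\<Gamma> (u \<circ> word_map F w)))"
  proof (intro sum.cong refl arg_cong2[where f="(*)"])
    fix w assume "w \<in> J"
    hence "(\<phi> \<circ> word_map F w) x = 1" for x using J(2) \<phi>(4) by (auto simp: cell_def)
    thus "\<E> (u \<circ> word_map F w) = (\<integral>x. (\<phi> \<circ> word_map F w) x \<partial>\<Gamma> (u \<circ> word_map F w))"
      using energy_measure_total[OF comp_word_map_mem[OF u], of w] by simp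
  qed
  also have "\<dots> \<le> (\<Sum>w\<in>words s. weight w * (\<integral>x. (\<phi> \<circ> word_map F w) x \<partial>\<Gamma> (u \<circ> word_map F w)))"
    using J(1) weight_pos \<phi>(2)
    by (intro sum_mono2 finite_words s mult_nonneg_nonneg Bochner_Integration.integral_nonneg) (auto intro: less_imp_le)
  also have "\<dots> = (\<integral>x. \<phi> x \<partial>\<Gamma> u)" by (rule energy_measure_words[OF s u \<phi>(1), symmetric])
  also have "\<dots> \<le> (\<integral>x. indicator U x \<partial>\<Gamma> u)"
  proof (rule integral_mono)
    interpret finite_measure "\<Gamma> u" by (rule finite_energy_measure[OF u])
    have "\<phi> \<in> borel_measurable (\<Gamma> u)"
      using borel_measurable_continuous_onI[OF mem_continuous[OF \<phi>(1)]]
        measurable_cong_sets[OF sets_energy_measure[OF u] refl] by blast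
    thus "integrable (\<Gamma> u) \<phi>" using \<phi>(2,3) by (intro integrable_const_bound[of _ 1]) auto
    have "U \<in> sets (\<Gamma> u)" using U by (simp add: sets_energy_measure[OF u])
    thus "integrable (\<Gamma> u) (indicator U :: 'a \<Rightarrow> real)"
      by (intro integrable_real_indicator) (simp_all add: less_top[symmetric])
    show "\<phi> x \<le> indicator U x" for x using \<phi>(3,5) by (auto split: split_indicator)
  qed
  also have "\<dots> = measure (\<Gamma> u) U" using U by (simp add: sets_energy_measure[OF u] Int_absorb2 sets_eq_imp_space_eq[OF sets_energy_measure[OF u]])
  finally show ?thesis .
qed

end

end

context pcf_form_measure begin

section \<open>The limit of the Korevaar--Schoen functionals\<close>

lemma near_words_close:
  assumes "0 < \<eta>"
  obtains t0 where "0 < t0"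
    "\<And>t E x v. 0 < t \<Longrightarrow> t \<le> t0 \<Longrightarrow> v \<in> near_words t E \<Longrightarrow> x \<in> cell v \<Longrightarrow> infdist x (closure E) \<le> \<eta>"
proof -
  obtain t0 where t0: "0 < t0" "\<And>s w x y. 0 < s \<Longrightarrow> s \<le> t0 \<Longrightarrow> w \<in> words s \<Longrightarrow> x \<in> cell w \<Longrightarrow> y \<in> cell w \<Longrightarrow> dist x y < \<eta> / 2"
    using small_cells[of "\<eta> / 2"] assms by (metis half_gt_zero)
  show ?thesis
  proof (rule that[OF t0(1)])
    fix t E x v assume t: "0 < t" "t \<le> t0" and v: "v \<in> near_words t E" and x: "x \<in> cell v"
    obtain w y z where w: "v \<in> words t" "w \<in> words t" "y \<in> cell w" "y \<in> E" "z \<in> cell v" "z \<in> cell w"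
      using v by (auto simp: near_words_def neighbours_def)
    have "dist x y \<le> dist x z + dist z y" by (rule dist_triangle)
    also have "\<dots> \<le> \<eta>" using t0(2)[OF t w(1) x w(5)] t0(2)[OF t w(2) w(6) w(3)] by simp
    finally have "dist x y \<le> \<eta>" .
    moreover have "infdist x (closure E) \<le> dist x y" using w(4) closure_subset by (intro infdist_le) blast
    ultimately show "infdist x (closure E) \<le> \<eta>" by simp
  qed
qed

lemma korevaar_schoen_cong:
  assumes "\<And>x. x \<in> E \<Longrightarrow> u x = g x"
    and "\<And>x y. x \<in> E \<Longrightarrow> y \<in> resistance_ball p \<E> \<F> x s \<Longrightarrow> u y = g y"
  shows "korevaar_schoen p \<E> \<F> d m E u s = korevaar_schoen p \<E> \<F> d m E g s"
proof -
  have "(\<integral>\<^sup>+y\<in>resistance_ball p \<E> \<F> x s. ennreal (\<bar>u x - u y\<bar> powr p / s powr (d + p - 1)) \<partial>m) =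
    (\<integral>\<^sup>+y\<in>resistance_ball p \<E> \<F> x s. ennreal (\<bar>g x - g y\<bar> powr p / s powr (d + p - 1)) \<partial>m)" if "x \<in> E" for x
    using assms(1)[OF that] assms(2)[OF that] by (intro nn_integral_cong) (auto split: split_indicator)
  thus ?thesis unfolding korevaar_schoen_def by (intro nn_integral_cong) (auto split: split_indicator)
qed

lemma korevaar_schoen_cong_AE:
  assumes ae: "AE x in m. f x = v x"
  shows "korevaar_schoen p \<E> \<F> d m E f s = korevaar_schoen p \<E> \<F> d m E v s"
proof -
  have inner: "(\<integral>\<^sup>+y\<in>B. ennreal (\<bar>f x - f y\<bar> powr p / c) \<partial>m) = (\<integral>\<^sup>+y\<in>B. ennreal (\<bar>v x - v y\<bar> powr p / c) \<partial>m)"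
    if "f x = v x" for x B c
  proof (rule nn_integral_cong_AE)
    show "AE y in m. ennreal (\<bar>f x - f y\<bar> powr p / c) * indicator B y = ennreal (\<bar>v x - v y\<bar> powr p / c) * indicator B y"
      using ae by eventually_elim (simp add: that)
  qed
  show ?thesis unfolding korevaar_schoen_def
  proof (rule nn_integral_cong_AE)
    show "AE x in m.
      1 / emeasure m (resistance_ball p \<E> \<F> x s) *
        (\<integral>\<^sup>+y\<in>resistance_ball p \<E> \<F> x s. ennreal (\<bar>f x - f y\<bar> powr p / s powr (d + p - 1)) \<partial>m) * indicator E x =
      1 / emeasure m (resistance_ball p \<E> \<F> x s) *
        (\<integral>\<^sup>+y\<in>resistance_ball p \<E> \<F> x s. ennreal (\<bar>v x - v y\<bar> powr p / s powr (d + p - 1)) \<partial>m) * indicator E x"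
      using ae
    proof eventually_elim
      case (elim x)
      show ?case by (simp only: inner[OF elim])
    qed
  qed
qed

text \<open>
  For small \<open>s\<close> all cells near \<open>E\<close> lie in the
  \<open>\<eta>\<close>-neighbourhood of the closure of \<open>E\<close>, where \<open>u\<close>
  coincides with a global function \<open>g \<in> \<F>\<close>. Hence the \<open>Limsup\<close> is
  at most a constant times the energy measure of \<open>g\<close> on the \<open>2
  \<eta>\<close>-neighbourhood, and these neighbourhoods decrease to the closure of
  \<open>E\<close>.
\<close>

lemma Limsup_korevaar_schoen_le:
  fixes \<Gamma> :: "('a \<Rightarrow> real) \<Rightarrow> 'a measure"
  assumes K: "0 < K" and \<alpha>: "0 < \<alpha>"
    and ball: "\<And>s E x. 0 < s \<Longrightarrow> x \<in> E \<Longrightarrow> resistance_ball p \<E> \<F> x s \<subseteq> (\<Union>v\<in>near_words (s / \<alpha>) E. cell v)"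
    and bound: "\<And>u s E. u \<in> \<F> \<Longrightarrow> 0 < s \<Longrightarrow> korevaar_schoen p \<E> \<F> d m E u s
       \<le> ennreal (K * (\<Sum>v\<in>near_words (s / \<alpha>) E. weight v * \<E> (u \<circ> word_map F v)))"
    and \<Gamma>: "\<And>u. u \<in> \<F> \<Longrightarrow> is_p_energy_measure p \<E> \<F> u (\<Gamma> u)"
    and E': "open E'" "closure E \<subseteq> E'" and u: "u \<in> local_domain \<F> E'"
    and \<nu>: "is_local_p_energy_measure \<F> \<Gamma> E' u \<nu>"
  shows "Limsup (at_right 0) (korevaar_schoen p \<E> \<F> d m E u) \<le> ennreal K * emeasure \<nu> (closure E)"
proof (cases "E = {}")
  case True
  have "korevaar_schoen p \<E> \<F> d m E u = (\<lambda>_. 0)" using True by (simp add: korevaar_schoen_def fun_eq_iff)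
  thus ?thesis by (simp add: Limsup_const)
next
  case False
  define C where "C = closure E"
  have C: "closed C" "C \<noteq> {}" "C \<subseteq> E'" using False E' by (auto simp: C_def)
  have cpt: "compact A" if "closed A" for A :: "'a set"
    using closed_Int_compact[OF that compact_UNIV] by simp
  define U where "U \<eta> = {x. infdist x C < \<eta>}" for \<eta>
  define A where "A \<eta> = {x. infdist x C \<le> \<eta>}" for \<eta>
  have cont: "continuous_on UNIV (\<lambda>x. infdist x C)" by (intro continuous_on_infdist continuous_on_id)
  have U: "open (U \<eta>)" for \<eta> unfolding U_def by (intro open_Collect_less cont continuous_on_const)
  have A: "closed (A \<eta>)" for \<eta> unfolding A_def by (intro closed_Collect_le cont continuous_on_const)
  have CU: "C \<subseteq> U \<eta>" if "0 < \<eta>" for \<eta> using that by (auto simp: U_def)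
  obtain e where e: "0 < e" "(\<Union>x\<in>C. ball x e) \<subseteq> E'"
    using compact_subset_open_imp_ball_epsilon_subset[OF cpt[OF C(1)] E'(1) C(3)] by blast
  define V where "V = U (e / 2)"
  have "A (e / 2) \<subseteq> E'"
  proof
    fix x assume "x \<in> A (e / 2)"
    hence "infdist x C < e" using e(1) by (simp add: A_def)
    hence "\<exists>y\<in>C. dist x y < e" using C(2) by (auto simp: infdist_notempty cInf_less_iff)
    then obtain y where "y \<in> C" "x \<in> ball y e" by (auto simp: dist_commute)
    thus "x \<in> E'" using e(2) by blast
  qed
  moreover have "closure V \<subseteq> A (e / 2)" by (intro closure_minimal A) (auto simp: V_def U_def A_def)
  ultimately have rel: "rel_compact E' V" using cpt[OF closed_closure] by (auto simp: rel_compact_def)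
  have V: "open V" "C \<subseteq> V" using U CU e by (auto simp: V_def)
  have "\<exists>g\<in>\<F>. \<forall>x\<in>V. u x = g x" using u V(1) rel by (simp add: local_domain_def)
  then obtain g where g: "g \<in> \<F>" "\<And>x. x \<in> V \<Longrightarrow> u x = g x" by blast
  have "rel_compact E' C" using C cpt by (simp add: rel_compact_def)
  hence \<nu>C: "emeasure \<nu> C = emeasure (\<Gamma> g) C"
  proof -
    have *: "\<And>E A g. E \<in> sets borel \<and> rel_compact E' E \<and> open A \<and> rel_compact E' A \<and> E \<subseteq> A \<and>
        g \<in> \<F> \<and> (\<forall>x\<in>A. u x = g x) \<Longrightarrow> emeasure \<nu> E = emeasure (\<Gamma> g) E"
      using \<nu> unfolding is_local_p_energy_measure_def by blast
    show ?thesis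
      by (rule *[of C V g]) (intro conjI ballI V rel g borel_closed[OF C(1)] \<open>rel_compact E' C\<close>)
  qed
  interpret finite_measure "\<Gamma> g" using \<Gamma>[OF g(1)] by (simp add: is_p_energy_measure_def)
  have sets_g: "sets (\<Gamma> g) = sets borel" using \<Gamma>[OF g(1)] by (simp add: is_p_energy_measure_def)
  have le: "Limsup (at_right 0) (korevaar_schoen p \<E> \<F> d m E u) \<le> ennreal K * emeasure (\<Gamma> g) (U (2 * \<eta>))"
    if \<eta>: "0 < \<eta>" "\<eta> < e / 2" for \<eta>
  proof (rule Limsup_bounded)
    obtain t0 where t0: "0 < t0"
      "\<And>t E x v. 0 < t \<Longrightarrow> t \<le> t0 \<Longrightarrow> v \<in> near_words t E \<Longrightarrow> x \<in> cell v \<Longrightarrow> infdist x (closure E) \<le> \<eta>"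
      using near_words_close[OF \<eta>(1)] by blast
    have "\<forall>\<^sub>F s in at_right 0. 0 < s \<and> s < t0 * \<alpha>"
      using t0(1) \<alpha> eventually_at_right_real[of 0 "t0 * \<alpha>"] by simp
    thus "\<forall>\<^sub>F s in at_right 0. korevaar_schoen p \<E> \<F> d m E u s \<le> ennreal K * emeasure (\<Gamma> g) (U (2 * \<eta>))"
    proof eventually_elim
      case (elim s)
      hence t: "0 < s / \<alpha>" "s / \<alpha> \<le> t0" using \<alpha> by (auto simp: field_simps)
      have cells: "(\<Union>v\<in>near_words (s / \<alpha>) E. cell v) \<subseteq> A \<eta>"
        using t0(2)[OF t] by (auto simp: A_def C_def)
      have AV: "A \<eta> \<subseteq> V" "A \<eta> \<subseteq> U (2 * \<eta>)" using \<eta> by (auto simp: A_def V_def U_def)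
      have "korevaar_schoen p \<E> \<F> d m E u s = korevaar_schoen p \<E> \<F> d m E g s"
      proof (rule korevaar_schoen_cong)
        show "u x = g x" if "x \<in> E" for x using that V(2) closure_subset by (intro g) (auto simp: C_def)
        show "u y = g y" if "x \<in> E" "y \<in> resistance_ball p \<E> \<F> x s" for x y
          using ball[of s x E] elim that cells AV by (intro g) blast
      qed
      also have "\<dots> \<le> ennreal (K * (\<Sum>v\<in>near_words (s / \<alpha>) E. weight v * \<E> (g \<circ> word_map F v)))"
        using elim by (intro bound g) simp
      also have "\<dots> \<le> ennreal (K * measure (\<Gamma> g) (U (2 * \<eta>)))"
      proof (intro ennreal_leI mult_left_mono)
        show "(\<Sum>v\<in>near_words (s / \<alpha>) E. weight v * \<E> (g \<circ> word_map F v)) \<le> measure (\<Gamma> g) (U (2 * \<eta>))"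
          by (rule cell_energies_le_energy_measure[OF \<Gamma> t(1) g(1) _ cells A AV(2) U])
             (auto simp: near_words_def neighbours_def)
      qed (use K in simp)
      also have "\<dots> = ennreal K * emeasure (\<Gamma> g) (U (2 * \<eta>))"
        using K by (simp add: ennreal_mult emeasure_eq_measure)
      finally show ?case .
    qed
  qed
  have "(\<lambda>n. emeasure (\<Gamma> g) (U (1 / real (Suc n)))) \<longlonglongrightarrow> emeasure (\<Gamma> g) (\<Inter>n. U (1 / real (Suc n)))"
  proof (rule Lim_emeasure_decseq)
    show "decseq (\<lambda>n. U (1 / real (Suc n)))"
    proof (intro decseq_SucI subsetI)
      fix n x assume "x \<in> U (1 / real (Suc (Suc n)))"
      moreover have "1 / real (Suc (Suc n)) \<le> 1 / real (Suc n)" by (intro frac_le) auto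
      ultimately show "x \<in> U (1 / real (Suc n))" unfolding U_def by simp
    qed
  qed (use U in \<open>auto simp: sets_g\<close>)
  also have "(\<Inter>n. U (1 / real (Suc n))) = C"
  proof (intro equalityI subsetI)
    fix x assume "x \<in> (\<Inter>n. U (1 / real (Suc n)))"
    hence *: "infdist x C < 1 / real (Suc n)" for n by (auto simp: U_def)
    have "\<not> 0 < infdist x C"
    proof
      assume "0 < infdist x C"
      then obtain n where "1 / real (Suc n) < infdist x C"
        using reals_Archimedean unfolding inverse_eq_divide by blast
      thus False using *[of n] by simp
    qed
    hence "infdist x C = 0" using infdist_nonneg[of x C] by simp
    thus "x \<in> C" using in_closed_iff_infdist_zero[OF C(1,2)] by simp
  next
    fix x assume "x \<in> C"
    hence "x \<in> U (1 / real (Suc n))" for n using CU[of "1 / real (Suc n)"] by auto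
    thus "x \<in> (\<Inter>n. U (1 / real (Suc n)))" by blast
  qed
  finally have lim: "(\<lambda>n. ennreal K * emeasure (\<Gamma> g) (U (1 / real (Suc n)))) \<longlonglongrightarrow> ennreal K * emeasure (\<Gamma> g) C"
    by (intro ennreal_tendsto_cmult) auto
  obtain N where N: "1 / real (Suc N) < e" using reals_Archimedean[OF e(1)] unfolding inverse_eq_divide by blast
  have "Limsup (at_right 0) (korevaar_schoen p \<E> \<F> d m E u) \<le> ennreal K * emeasure (\<Gamma> g) C"
  proof (rule LIMSEQ_le_const[OF lim], intro exI[of _ N] allI impI)
    fix n assume "N \<le> n"
    define \<eta> where "\<eta> = 1 / real (Suc n) / 2"
    have double: "2 * (r / 2) = r" for r :: real by simp
    have "1 / real (Suc n) \<le> 1 / real (Suc N)" using \<open>N \<le> n\<close> by (intro frac_le) auto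
    hence "\<eta> < e / 2" using N unfolding \<eta>_def by (intro divide_strict_right_mono) linarith+
    moreover have "0 < \<eta>" "2 * \<eta> = 1 / real (Suc n)" unfolding \<eta>_def double by simp_all
    ultimately show "Limsup (at_right 0) (korevaar_schoen p \<E> \<F> d m E u) \<le> ennreal K * emeasure (\<Gamma> g) (U (1 / real (Suc n)))"
      using le[of \<eta>] by (simp only:)
  qed
  thus ?thesis using \<nu>C by (simp add: C_def)
qed

lemma korevaar_schoen_le_extended_energy:
  assumes K: "0 < K" and \<alpha>: "0 < \<alpha>"
    and bound: "\<And>u s E. u \<in> \<F> \<Longrightarrow> 0 < s \<Longrightarrow> korevaar_schoen p \<E> \<F> d m E u s
       \<le> ennreal (K * (\<Sum>v\<in>near_words (s / \<alpha>) E. weight v * \<E> (u \<circ> word_map F v)))"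
    and s: "0 < s"
  shows "korevaar_schoen p \<E> \<F> d m E f s \<le> ennreal K * extended_energy \<E> \<F> m f"
proof (cases "\<exists>v\<in>\<F>. AE x in m. f x = v x")
  case True
  then obtain v where v: "v \<in> \<F>" "AE x in m. f x = v x" by blast
  have t: "0 < s / \<alpha>" using s \<alpha> by simp
  have "korevaar_schoen p \<E> \<F> d m E f s = korevaar_schoen p \<E> \<F> d m E v s"
    by (rule korevaar_schoen_cong_AE[OF v(2)])
  also have "\<dots> \<le> ennreal (K * (\<Sum>w\<in>near_words (s / \<alpha>) E. weight w * \<E> (v \<circ> word_map F w)))"
    by (rule bound[OF v(1) s])
  also have "\<dots> \<le> ennreal (K * \<E> v)"
    unfolding energy_sum_words[OF t v(1)] using K
    by (intro ennreal_leI mult_left_mono sum_mono2 finite_words t weighted_energy_nonneg v)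
       (auto simp: near_words_def neighbours_def)
  also have "\<dots> = ennreal K * extended_energy \<E> \<F> m f"
    using K energy_nonneg[OF v(1)] by (simp add: extended_energy_eq[OF v] ennreal_mult)
  finally show ?thesis .
next
  case False
  hence "extended_energy \<E> \<F> m f = \<infinity>" unfolding extended_energy_def by simp
  thus ?thesis using K by (simp add: ennreal_mult_top)
qed

end

theorem proposition6p15:
  fixes F :: "'s::finite \<Rightarrow> 'a::metric_space \<Rightarrow> 'a"
    and p d :: real
    and \<rho> :: "'s \<Rightarrow> real"
    and \<E> :: "('a \<Rightarrow> real) \<Rightarrow> real"
    and \<F> :: "('a \<Rightarrow> real) set"
    and m :: "'a measure"
  assumes "1 < p"
    and "pcf_self_similar_structure F"
    and "connected (UNIV :: 'a set)"
    and "self_similar_p_resistance_form F p \<rho> \<E> \<F>"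
    and "\<And>i. \<rho> i > 1"
    and "d > 0"
    and "(\<Sum>i\<in>UNIV. \<rho> i powr (- d / (p - 1))) = 1"
    and "self_similar_measure F (\<lambda>i. \<rho> i powr (- d / (p - 1))) m"
  shows "\<exists>C::real. C > 0 \<and>
    (\<forall>\<Gamma>. (\<forall>u\<in>\<F>. is_p_energy_measure p \<E> \<F> u (\<Gamma> u)) \<longrightarrow>
      (\<forall>E E' u \<nu>.
         E \<in> sets borel \<and> open E' \<and> E' \<noteq> {} \<and> closure E \<subseteq> E' \<and> u \<in> local_domain \<F> E' \<and>
         is_local_p_energy_measure \<F> \<Gamma> E' u \<nu> \<longrightarrow>
         Limsup (at_right 0) (korevaar_schoen p \<E> \<F> d m E u) \<le> ennreal C * emeasure \<nu> (closure E))) \<and>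
    (\<forall>f. f \<in> borel_measurable m \<and> integrable m (\<lambda>x. \<bar>f x\<bar> powr p) \<longrightarrow>
       (SUP s\<in>{0<..}. korevaar_schoen p \<E> \<F> d m UNIV f s) \<le> ennreal C * extended_energy \<E> \<F> m f)"
proof -
  obtain chi where chi: "coding_map F chi" "finite (\<Union>n\<in>{1..}. (shift ^^ n) ` critical_set F chi)"
    using assms(2) unfolding pcf_self_similar_structure_def by blast
  interpret pcf_form_measure p \<E> \<F> F \<rho> chi d m
  proof
    show "p_resistance_form p \<E> \<F>"
      using assms(4) unfolding self_similar_p_resistance_form_def by (elim conjE)
    show "self_similar_structure F" using assms(2) by (simp add: pcf_self_similar_structure_def)
  qed (fact assms chi)+
  obtain K \<alpha> where K: "0 < K" "0 < \<alpha>"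
    "\<And>s E x. 0 < s \<Longrightarrow> x \<in> E \<Longrightarrow> resistance_ball p \<E> \<F> x s \<subseteq> (\<Union>v\<in>near_words (s / \<alpha>) E. cell v)"
    "\<And>u s E. u \<in> \<F> \<Longrightarrow> 0 < s \<Longrightarrow> korevaar_schoen p \<E> \<F> d m E u s
       \<le> ennreal (K * (\<Sum>v\<in>near_words (s / \<alpha>) E. weight v * \<E> (u \<circ> word_map F v)))"
    by (rule korevaar_schoen_le_cell_energies) blast
  have "Limsup (at_right 0) (korevaar_schoen p \<E> \<F> d m E u) \<le> ennreal K * emeasure \<nu> (closure E)"
    if "\<forall>u\<in>\<F>. is_p_energy_measure p \<E> \<F> u (\<Gamma> u)" "open E'" "closure E \<subseteq> E'" "u \<in> local_domain \<F> E'"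
      "is_local_p_energy_measure \<F> \<Gamma> E' u \<nu>" for \<Gamma> E E' u \<nu>
    by (rule Limsup_korevaar_schoen_le[OF K _ that(2-5)]) (assumption | rule bspec[OF that(1)])+
  moreover have "(SUP s\<in>{0<..}. korevaar_schoen p \<E> \<F> d m UNIV f s) \<le> ennreal K * extended_energy \<E> \<F> m f" for f
    by (rule SUP_least, rule korevaar_schoen_le_extended_energy[OF K(1,2) K(4)]) auto
  ultimately show ?thesis using K(1) by blast
qed

end
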